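(* Let $n\ge 1$ be an integer and let $\lambda\in[-(2n+2)(2n+3),\,-(2n)(2n+1))$. Then for every $k\in\{1,2,\dots,n\}$ there exists at least one solution $U_k:\mathbb{S}^3\to\mathbb{R}$ of $$\Delta_{\mathbb{S}^3}U=\lambda\,(U^5-U),\qquad U>0\quad\text{on }\mathbb{S}^3,$$ of the form $U_k=u_k(\theta)$ (a function of the coordinate $\theta$ only), where $u_k$ has the following properties: (i) $u_k$ has exactly $k$ local maxima on $(0,\pi/2)$; (ii) $u_k(\pi/2-\theta)=u_k(\theta)$ for $\theta\in(0,\pi/2)$; (iii) $u_k(0)<1$.
   Context: $\mathbb{S}^3\subset\mathbb{R}^4$ is the unit sphere with the round metric and $\Delta_{\mathbb{S}^3}$ is its Laplace–Beltrami operator (with the sign convention $\Delta=\mathrm{div}\,\nabla$). Points of $\mathbb{S}^3$ are written as $(\cos\theta\cos\eta_1,\cos\theta\sin\eta_1,\sin\theta\cos\eta_2,\sin\theta\sin\eta_2)$ with $0\le\theta\le\pi/2$ and $\eta_1,\eta_2\in[0,2\pi]$, so $\theta$ is the geodesic distance to the circle $\mathbb{S}^1\times\{0\}$. Functions of $\theta$ only are exactly those invariant under the action of $\mathbb{T}^2=\mathbb{S}^1\times\mathbb{S}^1$ on $\mathbb{S}^3\subset\mathbb{C}^2$ by complex multiplication in each factor. For $U=u(\theta)$ one has $\Delta_{\mathbb{S}^3}U=u''(\theta)+2\frac{\cos(2\theta)}{\sin(2\theta)}u'(\theta)$. *)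

theory Defs
  imports "HOL-Analysis.Analysis"
begin

abbreviation S3 :: "(real^4) set" where
  "S3 \<equiv> sphere 0 1"

definition torus_point :: "real \<Rightarrow> real \<Rightarrow> real \<Rightarrow> real^4" where
  "torus_point \<theta> \<eta>1 \<eta>2 =
     vector [cos \<theta> * cos \<eta>1, cos \<theta> * sin \<eta>1, sin \<theta> * cos \<eta>2, sin \<theta> * sin \<eta>2]"

text \<open>
  Functions and vector fields on the sphere are maps on \<open>real^4\<close> of which only the values
  on \<^const>\<open>S3\<close> matter. A derivative at \<open>p\<close> within \<^const>\<open>S3\<close> is determined
  only on the tangent space \<open>{v. v \<bullet> p = 0}\<close> (see \<open>tangent_derivative_unique\<close> below);
  the conditions \<open>v \<bullet> p = 0\<close> and \<open>M *v p = 0\<close> make the choices below unique,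
  and they exist wherever the map is differentiable within \<^const>\<open>S3\<close>
  (\<open>sphere_grad_works\<close>, \<open>sphere_jacobian_works\<close>).
\<close>

definition sphere_grad :: "(real^4 \<Rightarrow> real) \<Rightarrow> real^4 \<Rightarrow> real^4" where
  "sphere_grad U p =
     (THE v. v \<bullet> p = 0 \<and> (U has_derivative (\<lambda>h. v \<bullet> h)) (at p within S3))"

definition sphere_jacobian :: "(real^4 \<Rightarrow> real^4) \<Rightarrow> real^4 \<Rightarrow> real^4^4" where
  "sphere_jacobian X p =
     (THE M. M *v p = 0 \<and> (X has_derivative (\<lambda>h. M *v h)) (at p within S3))"

text \<open>
  The covariant derivative of a tangent field \<open>X\<close> in a direction \<open>v\<close> is the tangential part of
  \<open>M *v v\<close>, where \<open>M\<close> is the Jacobian above, so the divergence is the sum of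
  \<open>e \<bullet> (M *v e)\<close> over an orthonormal basis of the tangent space. Adding the vanishing term
  \<open>p \<bullet> (M *v p)\<close> turns this into the full trace of \<open>M\<close>.
\<close>

definition sphere_div :: "(real^4 \<Rightarrow> real^4) \<Rightarrow> real^4 \<Rightarrow> real" where
  "sphere_div X p = trace (sphere_jacobian X p)"

definition laplace_beltrami :: "(real^4 \<Rightarrow> real) \<Rightarrow> real^4 \<Rightarrow> real" where
  "laplace_beltrami U = sphere_div (sphere_grad U)"

definition C2_on_S3 :: "(real^4 \<Rightarrow> real) \<Rightarrow> bool" where
  "C2_on_S3 U \<longleftrightarrow>
     U differentiable_on S3 \<and> sphere_grad U differentiable_on S3 \<and>
     continuous_on S3 (sphere_jacobian (sphere_grad U))"

definition local_max_at :: "(real \<Rightarrow> real) \<Rightarrow> real \<Rightarrow> bool" where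
  "local_max_at u \<theta> \<longleftrightarrow> (\<forall>\<^sub>F t in at \<theta>. u t \<le> u \<theta>)"

lemma tangent_derivative_unique:
  fixes f :: "real^4 \<Rightarrow> 'b::real_normed_vector"
  assumes p: "p \<in> S3" and v: "v \<bullet> p = 0"
    and A: "(f has_derivative A) (at p within S3)"
    and B: "(f has_derivative B) (at p within S3)"
  shows "A v = B v"
proof -
  have *: "A v = B v" if n: "norm v = 1" and v: "v \<bullet> p = 0" for v
  proof -
    define c where "c t = cos t *\<^sub>R p + sin t *\<^sub>R v" for t :: real
    have pp: "p \<bullet> p = 1" and vv: "v \<bullet> v = 1"
      using p n by (auto simp: dot_square_norm)
    have "c t \<bullet> c t = 1" for t
      using v by (simp add: c_def inner_add_left inner_add_right pp vv inner_commute[of p v]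
          flip: power2_eq_square)
    then have c: "c ` UNIV \<subseteq> S3"
      by (auto simp: norm_eq_sqrt_inner)
    have c': "(c has_derivative (\<lambda>t. t *\<^sub>R v)) (at 0)"
      unfolding c_def by (auto intro!: derivative_eq_intros)
    have c0: "c 0 = p" by (simp add: c_def)
    have ch: "((\<lambda>t. f (c t)) has_derivative (\<lambda>t. D (t *\<^sub>R v))) (at 0)"
      if "(f has_derivative D) (at p within S3)" for D
      using has_derivative_in_compose[OF c', of f D]
        has_derivative_subset[OF that c] c0 by simp
    show ?thesis
      using has_derivative_unique[OF ch[OF A] ch[OF B]] by (metis scaleR_one)
  qed
  show ?thesis
  proof (cases "v = 0")
    case True
    then show ?thesis
      using A B by (metis has_derivative_bounded_linear linear_0 bounded_linear.linear)
  next
    case False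
    then have "A (v /\<^sub>R norm v) = B (v /\<^sub>R norm v)"
      using v by (intro *) auto
    moreover have "linear A" "linear B"
      using A B has_derivative_bounded_linear bounded_linear.linear by blast+
    ultimately show ?thesis
      using False by (simp add: linear_cmul)
  qed
qed

lemma sphere_grad_eqI:
  assumes p: "p \<in> S3" and v: "v \<bullet> p = 0"
    and D: "(U has_derivative (\<lambda>h. v \<bullet> h)) (at p within S3)"
  shows "sphere_grad U p = v"
  unfolding sphere_grad_def
proof (rule the_equality)
  fix w assume w: "w \<bullet> p = 0 \<and> (U has_derivative (\<lambda>h. w \<bullet> h)) (at p within S3)"
  have "(w - v) \<bullet> p = 0" using v w by (simp add: inner_diff_left)
  then have "w \<bullet> (w - v) = v \<bullet> (w - v)"
    using tangent_derivative_unique[OF p _ _ D] w by blast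
  then have "(w - v) \<bullet> (w - v) = 0" by (simp add: inner_diff_left)
  then show "w = v" by simp
qed (use v D in blast)

lemma sphere_jacobian_eqI:
  assumes p: "p \<in> S3" and M: "M *v p = 0"
    and D: "(X has_derivative (\<lambda>h. M *v h)) (at p within S3)"
  shows "sphere_jacobian X p = M"
  unfolding sphere_jacobian_def
proof (rule the_equality)
  fix N assume N: "N *v p = 0 \<and> (X has_derivative (\<lambda>h. N *v h)) (at p within S3)"
  have pp: "p \<bullet> p = 1" using p by (simp add: dot_square_norm)
  have "N *v h = M *v h" for h
  proof -
    define v where "v = h - (h \<bullet> p) *\<^sub>R p"
    have "v \<bullet> p = 0" by (simp add: v_def inner_diff_left pp)
    then have "N *v v = M *v v"
      using tangent_derivative_unique[OF p _ _ D] N by blast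
    then show ?thesis
      using N M by (simp add: v_def matrix_vector_mult_diff_distrib matrix_vector_mult_scaleR)
  qed
  then show "N = M" by (simp add: matrix_eq)
qed (use M D in blast)


lemma tangential_derivative:
  fixes f :: "real^4 \<Rightarrow> 'b::real_normed_vector"
  assumes p: "p \<in> S3" and A: "(f has_derivative A) (at p within S3)"
  shows "(f has_derivative (\<lambda>h. A h - (h \<bullet> p) *\<^sub>R A p)) (at p within S3)"
proof -
  have pp: "p \<bullet> p = 1" using p by (simp add: dot_square_norm)
  have "((\<lambda>y. 1 - ((y - p) \<bullet> (y - p)) / 2) has_derivative (\<lambda>h. 0)) (at p within S3)"
    by (auto intro!: derivative_eq_intros)
  moreover have "1 - ((y - p) \<bullet> (y - p)) / 2 = y \<bullet> p" if "y \<in> S3" for y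
  proof -
    have "y \<bullet> y = 1" using that by (simp add: dot_square_norm)
    then show ?thesis
      by (simp add: inner_diff_left inner_diff_right pp inner_commute[of p y] field_simps)
  qed
  ultimately have 0: "((\<lambda>y. y \<bullet> p) has_derivative (\<lambda>h. 0)) (at p within S3)"
    using p by (metis (no_types, lifting) has_derivative_transform)
  have 1: "((\<lambda>y. y \<bullet> p) has_derivative (\<lambda>h. h \<bullet> p)) (at p within S3)"
    by (auto intro!: derivative_eq_intros)
  have "((\<lambda>y. (f y - (y \<bullet> p) *\<^sub>R A p) + (y \<bullet> p) *\<^sub>R A p) has_derivative
      (\<lambda>h. (A h - (h \<bullet> p) *\<^sub>R A p) + 0 *\<^sub>R A p)) (at p within S3)"
    by (intro has_derivative_add has_derivative_diff A
        bounded_linear.has_derivative[OF bounded_linear_scaleR_left] 0 1)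
  then show ?thesis by simp
qed

lemma sphere_grad_works:
  assumes p: "p \<in> S3" and U: "U differentiable (at p within S3)"
  shows "sphere_grad U p \<bullet> p = 0"
    and "(U has_derivative (\<lambda>h. sphere_grad U p \<bullet> h)) (at p within S3)"
proof -
  obtain A where A: "(U has_derivative A) (at p within S3)"
    using U by (auto simp: differentiable_def)
  define B where "B h = A h - (h \<bullet> p) *\<^sub>R A p" for h
  have B: "(U has_derivative B) (at p within S3)"
    unfolding B_def by (rule tangential_derivative[OF p A])
  then have "linear B"
    using has_derivative_bounded_linear bounded_linear.linear by blast
  then have rep: "B = (\<lambda>h. adjoint B 1 \<bullet> h)"
    using adjoint_works[of B] by (auto simp: fun_eq_iff inner_commute)
  have "B p = 0" using p by (simp add: B_def dot_square_norm)
  then have "adjoint B 1 \<bullet> p = 0" by (metis rep)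
  moreover from this have "sphere_grad U p = adjoint B 1"
    using sphere_grad_eqI[OF p] B rep by metis
  ultimately show "sphere_grad U p \<bullet> p = 0"
    and "(U has_derivative (\<lambda>h. sphere_grad U p \<bullet> h)) (at p within S3)"
    using B rep by auto
qed

lemma sphere_jacobian_works:
  assumes p: "p \<in> S3" and X: "X differentiable (at p within S3)"
  shows "sphere_jacobian X p *v p = 0"
    and "(X has_derivative (\<lambda>h. sphere_jacobian X p *v h)) (at p within S3)"
proof -
  obtain A where A: "(X has_derivative A) (at p within S3)"
    using X by (auto simp: differentiable_def)
  define B where "B h = A h - (h \<bullet> p) *\<^sub>R A p" for h
  have B: "(X has_derivative B) (at p within S3)"
    unfolding B_def by (rule tangential_derivative[OF p A])
  then have "linear B"
    using has_derivative_bounded_linear bounded_linear.linear by blast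
  then have rep: "matrix B *v h = B h" for h by (simp add: matrix_works)
  have "B p = 0" using p by (simp add: B_def dot_square_norm)
  then have "matrix B *v p = 0" by (simp add: rep)
  moreover from this have "sphere_jacobian X p = matrix B"
    using sphere_jacobian_eqI[OF p] B rep by simp
  ultimately show "sphere_jacobian X p *v p = 0"
    and "(X has_derivative (\<lambda>h. sphere_jacobian X p *v h)) (at p within S3)"
    using B rep by auto
qed

end

theory Submission imports Defs begin

text \<open>
In the variable \<open>s = sin\<^sup>2 \<theta>\<close>, which is the polynomial \<open>x\<^sub>3\<^sup>2 + x\<^sub>4\<^sup>2\<close> on the sphere, and with
\<open>\<mu> = - \<lambda>\<close>, the equation for \<open>U = W s\<close> reads
\<open>(s (1 - s) W')' = \<mu>/4 (W - W\<^sup>5)\<close>. Symmetric solutions correspond to solutions on \<open>[0, 1/2]\<close> with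
\<open>W' (1/2) = 0\<close>. We shoot from \<open>W 0 = 1 - e\<close>, writing \<open>W = 1 - e X\<close> with \<open>X 0 = 1\<close>: this desingularises
the problem at \<open>e = 0\<close>, where it becomes the Legendre equation, while \<open>X = 1\<close> for \<open>e = 1\<close>. The
Pruefer angle of \<open>(X, - s (1 - s) X')\<close> at \<open>s = 1/2\<close> is continuous in \<open>e\<close> on \<open>[0, 1]\<close> and vanishes
at \<open>e = 1\<close>. At \<open>e = 0\<close> it is strictly increasing in \<open>\<mu>\<close> by Sturm comparison and a multiple of \<open>pi\<close> for
\<open>\<mu> = 2 j (2 j + 1)\<close>, because the Legendre polynomial of degree \<open>2 j\<close> is even; hence it exceeds \<open>n pi\<close>
for \<open>\<mu> > 2 n (2 n + 1)\<close>, and each value \<open>k pi\<close> with \<open>1 \<le> k \<le> n\<close> is attained for some \<open>0 < e < 1\<close>. The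
energy keeps \<open>W\<close> positive, the angle is strictly increasing in \<open>s\<close>, and after reflection it runs
from \<open>0\<close> to \<open>2 k pi\<close>; the maxima of \<open>W\<close> are the points where it is an odd multiple of \<open>pi\<close>.
\<close>

section \<open>Radial initial value problems\<close>

lemma mult_mem_interval:
  fixes s t b :: real
  assumes "s \<in> {0..b}" "t \<in> {0..1}"
  shows "s * t \<in> {0..b}"
  using assms by (auto intro: order_trans[OF mult_left_le])

text \<open>Substitution \<open>r = s * \<tau>\<close>. Averaging over the fixed interval
  \<open>{0..1}\<close> splits off the factor \<open>s\<close> without a division, so the average
  stays meaningful and continuous at the singular end \<open>s = 0\<close>.\<close>

lemma mean_eq_integral:
  fixes \<phi> :: "real \<Rightarrow> real"
  assumes "continuous_on {0..b} \<phi>" "s \<in> {0..b}"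
  shows "s * integral {0..1} (\<lambda>\<tau>. \<phi> (s * \<tau>)) = integral {0..s} \<phi>"
proof -
  have "((\<lambda>\<tau>. s *\<^sub>R \<phi> (s * \<tau>)) has_integral integral {s * 0..s * 1} \<phi>) {0..1}"
  proof (rule has_integral_substitution)
    show "(*) s ` {0..1} \<subseteq> {0..b}"
      using assms by (auto intro: order_trans[OF mult_left_le])
    show "((*) s has_field_derivative s) (at x within {0..1})" for x
      by (auto intro!: derivative_eq_intros)
  qed (use assms in auto)
  then have "integral {0..1} (\<lambda>\<tau>. s * \<phi> (s * \<tau>)) = integral {0..s} \<phi>"
    by (intro integral_unique) simp
  then show ?thesis by simp
qed

lemma mean_has_derivative:
  fixes \<phi> :: "real \<Rightarrow> real"
  assumes c: "continuous_on {0..b} \<phi>" and s: "s \<in> {0..b}"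
  shows "((\<lambda>s. s * integral {0..1} (\<lambda>\<tau>. \<phi> (s * \<tau>))) has_real_derivative \<phi> s) (at s within {0..b})"
  by (rule has_field_derivative_transform_within[OF integral_has_real_derivative[OF c s] zero_less_one s])
     (use mean_eq_integral[OF c] in simp)

lemma mean_continuous:
  fixes \<phi> :: "'a::topological_space \<Rightarrow> real \<Rightarrow> real"
  assumes c: "continuous_on (T \<times> {0..b}) (\<lambda>(e, s). \<phi> e s)"
  shows "continuous_on (T \<times> {0..b}) (\<lambda>(e, s). integral {0..1} (\<lambda>\<tau>. \<phi> e (s * \<tau>)))"
proof -
  have "continuous_on ((T \<times> {0..b}) \<times> cbox 0 1) (\<lambda>(x, t). \<phi> (fst x) (snd x * t))"
    unfolding case_prod_beta
    by (rule continuous_on_compose2[OF c, unfolded case_prod_beta,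
          of _ "\<lambda>z. (fst (fst z), snd (fst z) * snd z)", simplified])
       (auto intro!: continuous_intros intro: order_trans[OF mult_left_le])
  from integral_continuous_on_param[OF this] show ?thesis
    by (simp add: case_prod_beta)
qed

text \<open>At the infimum of the points where \<open>f\<close> fails to be positive, continuity
  forces \<open>f = 0\<close> while \<open>f\<close> is nonnegative up to there, and
  \<open>step\<close> excludes this. Estimates valid only as long as \<open>f\<close> is nonnegative
  (Gronwall, energy) can thus be used in \<open>step\<close>.\<close>

lemma continuous_positive_by_first_exit:
  fixes f :: "real \<Rightarrow> real"
  assumes c: "continuous_on {a..b} f" and a: "f a > 0"
    and step: "\<And>s. s \<in> {a..b} \<Longrightarrow> (\<And>r. r \<in> {a..s} \<Longrightarrow> f r \<ge> 0) \<Longrightarrow> f s \<noteq> 0"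
    and s: "s \<in> {a..b}"
  shows "f s > 0"
proof (rule ccontr)
  assume "\<not> f s > 0"
  define Z where "Z = {r \<in> {a..s}. f r \<le> 0}"
  have "s \<in> Z" using \<open>\<not> f s > 0\<close> s by (auto simp: Z_def)
  have "closed Z" unfolding Z_def
    using s by (intro continuous_on_closed_Collect_le continuous_on_subset[OF c] continuous_intros) auto
  moreover have "bdd_below Z" by (auto simp: Z_def)
  ultimately have m: "Inf Z \<in> Z" using \<open>s \<in> Z\<close> closed_contains_Inf by blast
  have below: "f r > 0" if "r \<in> {a..<Inf Z}" for r
    using cInf_lower[OF _ \<open>bdd_below Z\<close>, of r] that m by (force simp: Z_def)
  have "\<forall>z\<in>Z. a \<le> z \<and> f z \<le> 0" by (auto simp: Z_def)
  then have "a \<le> Inf Z" "f (Inf Z) \<le> 0" using m by blast+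
  then have "a < Inf Z" using a by (metis less_le not_less)
  have cI: "continuous_on {a..Inf Z} f" using m s by (intro continuous_on_subset[OF c]) (auto simp: Z_def)
  have "f (Inf Z) \<ge> 0"
  proof (rule ccontr)
    assume neg: "\<not> f (Inf Z) \<ge> 0"
    then obtain r where "a \<le> r" "r \<le> Inf Z" "f r = 0"
      using IVT2'[of f "Inf Z" 0 a] a \<open>a < Inf Z\<close> cI by force
    then show False using below[of r] neg by (cases "r = Inf Z") auto
  qed
  then have "f (Inf Z) = 0" using m by (auto simp: Z_def)
  moreover have "f (Inf Z) \<noteq> 0"
  proof (rule step)
    show "f r \<ge> 0" if "r \<in> {a..Inf Z}" for r
      using below[of r] \<open>f (Inf Z) \<ge> 0\<close> that by (cases "r = Inf Z") (auto intro: less_imp_le)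
  qed (use m s in \<open>auto simp: Z_def\<close>)
  ultimately show False by simp
qed

text \<open>
  The fixed point is taken among bounded continuous functions of \<open>(e, s)\<close> jointly, so continuous
  dependence on the parameter needs no separate argument. The weight \<open>exp (- (K * s))\<close> turns the
  integral operator into a contraction.
\<close>

lemma radial_family_exists:
  fixes H :: "real \<Rightarrow> real \<Rightarrow> real"
  assumes contH: "continuous_on ({0..1} \<times> UNIV) (\<lambda>(e, x). H e x)"
    and lip: "\<And>e x y. e \<in> {0..1} \<Longrightarrow> \<bar>H e x - H e y\<bar> \<le> L * \<bar>x - y\<bar>" and L: "L > 0"
  obtains X A :: "real \<Rightarrow> real \<Rightarrow> real" where
    "continuous_on ({0..1} \<times> {0..1/2}) (\<lambda>(e, s). X e s)"
    "continuous_on ({0..1} \<times> {0..1/2}) (\<lambda>(e, s). A e s)"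
    "\<And>e s. e \<in> {0..1} \<Longrightarrow> s \<in> {0..1/2} \<Longrightarrow> A e s = integral {0..1} (\<lambda>\<tau>. H e (X e (s * \<tau>)))"
    "\<And>e s. e \<in> {0..1} \<Longrightarrow> s \<in> {0..1/2} \<Longrightarrow>
        X e s = 1 - s * integral {0..1} (\<lambda>\<tau>. A e (s * \<tau>) / (1 - s * \<tau>))"
proof -
  \<comment> \<open>On \<open>{0..1/2}\<close> the factor \<open>1 / (1 - r)\<close> is at most 2,
    and integrating \<open>2 * L * d * exp (K * r)\<close> up to \<open>s\<close> gives at most
    \<open>2 * L / K * d * exp (K * s)\<close>. The choice of \<open>K\<close> makes the contraction
    constant 1/2.\<close>
  define K where "K = 4 * L"
  have K: "K > 0" using L by (simp add: K_def)
  define D where "D = {0..1::real} \<times> {0..1/2::real}"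
  have D_cbox: "D = cbox (0, 0) (1, 1/2)" by (simp add: D_def cbox_Pair_eq)
  define R where "R V e s = H e (exp (K * s) * V (e, s))" for V :: "real \<times> real \<Rightarrow> real" and e s
  define A where "A V e s = integral {0..1} (\<lambda>\<tau>. R V e (s * \<tau>))" for V e s
  define B where "B V e s = integral {0..1} (\<lambda>\<tau>. A V e (s * \<tau>) / (1 - s * \<tau>))" for V e s
  define F where "F V = (\<lambda>(e, s). exp (- (K * s)) * (1 - s * B V e s))" for V
  have cR: "continuous_on D (\<lambda>(e, s). R V e s)" if "continuous_on D V" for V
  proof -
    have "continuous_on D (\<lambda>z. (fst z, exp (K * snd z) * V z))"
      using that by (intro continuous_intros)
    moreover have "(\<lambda>z. (fst z, exp (K * snd z) * V z)) ` D \<subseteq> {0..1} \<times> UNIV"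
      by (auto simp: D_def)
    ultimately show ?thesis
      using continuous_on_compose2[OF contH] by (force simp: R_def case_prod_beta)
  qed
  have cA: "continuous_on D (\<lambda>(e, s). A V e s)" if "continuous_on D V" for V
    using cR[OF that] unfolding A_def D_def by (rule mean_continuous)
  have cA': "continuous_on D (\<lambda>(e, s). A V e s / (1 - s))" if "continuous_on D V" for V
    using cA[OF that] unfolding case_prod_beta
    by (intro continuous_intros) (auto simp: D_def)
  have cB: "continuous_on D (\<lambda>(e, s). B V e s)" if "continuous_on D V" for V
    using cA'[OF that] unfolding B_def D_def by (rule mean_continuous)
  have cF: "continuous_on D (F V)" if "continuous_on D V" for V
    using cB[OF that] unfolding F_def case_prod_beta by (intro continuous_intros)
  have slice: "continuous_on {0..1/2} (f e)" if "continuous_on D (\<lambda>(e, s). f e s)" "e \<in> {0..1}"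
    for f :: "real \<Rightarrow> real \<Rightarrow> real" and e
    by (rule continuous_on_compose2[OF that(1), of _ "\<lambda>s. (e, s)", simplified])
       (use that(2) in \<open>auto intro!: continuous_intros simp: D_def\<close>)
  have slice': "continuous_on {0..1} (\<lambda>\<tau>. f e (s * \<tau>))"
    if "continuous_on D (\<lambda>(e, s). f e s)" "e \<in> {0..1}" "s \<in> {0..1/2}"
    for f :: "real \<Rightarrow> real \<Rightarrow> real" and e s
    by (rule continuous_on_compose2[OF slice[OF that(1,2)]])
       (use that(3) in \<open>auto intro!: continuous_intros mult_mem_interval simp del: atLeastAtMost_iff\<close>)
  have est: "\<bar>F V z - F V' z\<bar> \<le> 1/2 * d"
    if V: "continuous_on D V" and V': "continuous_on D V'" and z: "z \<in> D"
      and d: "\<And>z. z \<in> D \<Longrightarrow> \<bar>V z - V' z\<bar> \<le> d" for V V' z d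
  proof -
    obtain e s where z_eq: "z = (e, s)" and e: "e \<in> {0..1}" and s: "s \<in> {0..1/2}"
      using z by (auto simp: D_def)
    have "d \<ge> 0" using d[OF z] by linarith
    have dR: "\<bar>R V e r - R V' e r\<bar> \<le> L * d * exp (K * r)" if "r \<in> {0..1/2}" for r
    proof -
      have "\<bar>R V e r - R V' e r\<bar> \<le> L * \<bar>exp (K * r) * V (e, r) - exp (K * r) * V' (e, r)\<bar>"
        unfolding R_def by (rule lip[OF e])
      also have "\<bar>exp (K * r) * V (e, r) - exp (K * r) * V' (e, r)\<bar> = exp (K * r) * \<bar>V (e, r) - V' (e, r)\<bar>"
        by (simp add: abs_mult flip: right_diff_distrib)
      also have "L * \<dots> \<le> L * (exp (K * r) * d)"
        using L that e by (intro mult_left_mono d) (auto simp: D_def)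
      finally show ?thesis by (simp add: mult_ac)
    qed
    have dA: "\<bar>A V e r - A V' e r\<bar> \<le> L * d * exp (K * r)" if r: "r \<in> {0..1/2}" for r
    proof -
      have c: "continuous_on {0..1} (\<lambda>\<tau>. R V e (r * \<tau>))" "continuous_on {0..1} (\<lambda>\<tau>. R V' e (r * \<tau>))"
        using slice'[OF cR e r] V V' by blast+
      have "\<bar>R V e (r * t) - R V' e (r * t)\<bar> \<le> L * d * exp (K * r)" if t: "t \<in> {0..1}" for t
      proof -
        have "r * t \<in> {0..1/2}" "r * t \<le> r"
          using mult_mem_interval[OF r t] r t by (auto intro: mult_left_le)
        then show ?thesis using L K \<open>d \<ge> 0\<close>
          by (intro order_trans[OF dR] mult_left_mono) auto
      qed
      then have "norm (integral {0..1} (\<lambda>\<tau>. R V e (r * \<tau>) - R V' e (r * \<tau>))) \<le> L * d * exp (K * r) * (1 - 0)"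
        by (intro integral_bound continuous_intros c) auto
      then show ?thesis
        unfolding A_def using c by (simp add: integral_diff integrable_continuous_real)
    qed
    have cQ: "continuous_on {0..1/2} (\<lambda>r. A V e r / (1 - r))" "continuous_on {0..1/2} (\<lambda>r. A V' e r / (1 - r))"
      using slice[OF cA' e] V V' by blast+
    then have cQs: "continuous_on {0..s} (\<lambda>r. A V e r / (1 - r))" "continuous_on {0..s} (\<lambda>r. A V' e r / (1 - r))"
      using s by (auto elim: continuous_on_subset)
    have FTC: "((\<lambda>r. 2 * L * d * exp (K * r)) has_integral (2 * L * d * exp (K * s) / K - 2 * L * d * exp (K * 0) / K)) {0..s}"
      using K s by (intro fundamental_theorem_of_calculus)
        (auto intro!: derivative_eq_intros simp flip: has_real_derivative_iff_has_vector_derivative)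
    have "s * B V e s - s * B V' e s = integral {0..s} (\<lambda>r. A V e r / (1 - r)) - integral {0..s} (\<lambda>r. A V' e r / (1 - r))"
      unfolding B_def using mean_eq_integral[OF cQ(1) s] mean_eq_integral[OF cQ(2) s] by simp
    also have "\<dots> = integral {0..s} (\<lambda>r. A V e r / (1 - r) - A V' e r / (1 - r))"
      using cQs by (simp add: integral_diff integrable_continuous_real)
    also have "\<bar>\<dots>\<bar> \<le> integral {0..s} (\<lambda>r. 2 * L * d * exp (K * r))"
      unfolding real_norm_def[symmetric]
    proof (rule integral_norm_bound_integral, unfold real_norm_def)
      fix r assume r: "r \<in> {0..s}"
      have "A V e r / (1 - r) - A V' e r / (1 - r) = (A V e r - A V' e r) * (1 / (1 - r))"
        by (simp add: diff_divide_distrib)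
      then have "\<bar>A V e r / (1 - r) - A V' e r / (1 - r)\<bar> = \<bar>A V e r - A V' e r\<bar> * (1 / (1 - r))"
        using r s by (simp add: abs_mult)
      also have "\<dots> \<le> (L * d * exp (K * r)) * 2"
        using r s L \<open>d \<ge> 0\<close> by (intro mult_mono dA) (auto simp: field_simps)
      finally show "\<bar>A V e r / (1 - r) - A V' e r / (1 - r)\<bar> \<le> 2 * L * d * exp (K * r)"
        by (simp add: mult_ac)
    qed (use cQs in \<open>auto intro!: integrable_continuous_real continuous_intros\<close>)
    also have "\<dots> = d * exp (K * s) / 2 - d / 2"
      using FTC L by (subst integral_unique[OF FTC]) (simp add: K_def)
    also have "\<dots> \<le> d * exp (K * s) / 2" using \<open>d \<ge> 0\<close> by simp
    finally have *: "\<bar>s * B V e s - s * B V' e s\<bar> \<le> d * exp (K * s) / 2" .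
    have "\<bar>F V z - F V' z\<bar> = exp (- (K * s)) * \<bar>s * B V e s - s * B V' e s\<bar>"
      unfolding F_def z_eq by (simp add: abs_mult abs_minus_commute flip: right_diff_distrib)
    also have "\<dots> \<le> exp (- (K * s)) * (d * exp (K * s) / 2)" by (intro mult_left_mono *) auto
    also have "\<dots> = 1/2 * d" by (simp add: exp_minus)
    finally show ?thesis .
  qed
  \<comment> \<open>The Banach space consists of functions on the whole plane, so \<open>F V\<close>
    is restricted to the rectangle \<open>D\<close> and extended by \<open>clamp\<close>. Distances
    are then controlled by values on \<open>D\<close>, where \<open>est\<close> applies.\<close>
  have "\<forall>V :: (real \<times> real) \<Rightarrow>\<^sub>C real. \<exists>G :: (real \<times> real) \<Rightarrow>\<^sub>C real.
      (\<forall>z\<in>D. G z = F V z) \<and> (\<forall>z. G z = F V (clamp (0, 0) (1, 1/2) z))"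
  proof
    fix V :: "(real \<times> real) \<Rightarrow>\<^sub>C real"
    have "continuous_on (cbox (0, 0) (1, 1/2)) (F V)"
      using cF[of V] by (simp add: D_cbox)
    then obtain g :: "(real \<times> real) \<Rightarrow>\<^sub>C real"
      where "\<And>z. z \<in> cbox (0, 0) (1, 1/2) \<Longrightarrow> g z = F V z" "\<And>z. g z = F V (clamp (0, 0) (1, 1/2) z)"
      using continuous_on_cbox_bcontfunE by blast
    then show "\<exists>G :: (real \<times> real) \<Rightarrow>\<^sub>C real. (\<forall>z\<in>D. G z = F V z) \<and> (\<forall>z. G z = F V (clamp (0, 0) (1, 1/2) z))"
      unfolding D_cbox by blast
  qed
  then obtain G where G: "\<And>V z. z \<in> D \<Longrightarrow> apply_bcontfun (G V) z = F (apply_bcontfun V) z"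
      "\<And>V z. apply_bcontfun (G V) z = F (apply_bcontfun V) (clamp (0, 0) (1, 1/2) z)"
    by metis
  have "dist (G V) (G V') \<le> 1/2 * dist V V'" for V V'
  proof (rule dist_bound)
    fix z
    have "clamp (0, 0) (1, 1/2) z \<in> D"
      unfolding D_cbox by (rule clamp_in_interval) (auto simp: Basis_prod_def)
    then show "dist (G V z) (G V' z) \<le> 1/2 * dist V V'"
      unfolding G(2) dist_real_def
      by (intro est) (auto intro: order_trans[OF _ dist_bounded] simp flip: dist_real_def)
  qed
  then obtain V where "G V = V"
    using banach_fix_type[of "1/2" G] by auto
  then have V: "V z = F V z" if "z \<in> D" for z
    using G(1)[OF that, of V] by simp
  define X where "X e s = exp (K * s) * V (e, s)" for e s
  show thesis
  proof (rule that[of X "A V"])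
    show "continuous_on ({0..1} \<times> {0..1/2}) (\<lambda>(e, s). X e s)"
      unfolding X_def case_prod_beta by (auto intro!: continuous_intros)
    show "continuous_on ({0..1} \<times> {0..1/2}) (\<lambda>(e, s). A V e s)"
      using cA[of V] by (simp add: D_def)
    show "A V e s = integral {0..1} (\<lambda>\<tau>. H e (X e (s * \<tau>)))" for e s
      unfolding A_def R_def X_def ..
    show "X e s = 1 - s * integral {0..1} (\<lambda>\<tau>. A V e (s * \<tau>) / (1 - s * \<tau>))"
      if "e \<in> {0..1}" "s \<in> {0..1/2}" for e s
      using V[of "(e, s)"] that unfolding X_def F_def B_def D_def
      by (simp add: exp_minus)
  qed
qed

section \<open>Angles of radial systems\<close>

text \<open>The function \<open>f x * exp (C * x)\<close> is nondecreasing. The constant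
  \<open>C\<close> may have either sign; with \<open>- Q\<close> for \<open>f\<close> and a negative
  constant, the result is an upper bound for \<open>Q\<close>.\<close>

lemma gronwall_lower:
  fixes f :: "real \<Rightarrow> real"
  assumes "a \<le> b" and c: "continuous_on {a..b} f"
    and d: "\<And>x. a < x \<Longrightarrow> x < b \<Longrightarrow> \<exists>y. DERIV f x :> y \<and> y \<ge> - C * f x"
  shows "f b \<ge> f a * exp (- C * (b - a))"
proof -
  have "f a * exp (C * a) \<le> f b * exp (C * b)"
  proof (rule DERIV_nonneg_imp_increasing_open[OF \<open>a \<le> b\<close>, of "\<lambda>x. f x * exp (C * x)"])
    fix x assume "a < x" "x < b"
    then obtain y where y: "DERIV f x :> y" "y \<ge> - C * f x" using d by blast
    have "DERIV (\<lambda>x. f x * exp (C * x)) x :> (y + C * f x) * exp (C * x)"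
      by (auto intro!: derivative_eq_intros y(1) simp: algebra_simps)
    moreover have "(y + C * f x) * exp (C * x) \<ge> 0" using y(2) by auto
    ultimately show "\<exists>y. DERIV (\<lambda>x. f x * exp (C * x)) x :> y \<and> y \<ge> 0" by blast
  qed (auto intro!: continuous_intros c)
  then have "f a * exp (C * a) * exp (- C * b) \<le> f b * exp (C * b) * exp (- C * b)"
    by (intro mult_right_mono) auto
  then show ?thesis
    by (simp add: mult.assoc algebra_simps flip: exp_add)
qed

lemma DERIV_within_interior:
  fixes a b x :: real
  assumes "(f has_real_derivative D) (at x within {a..b})" "a < x" "x < b"
  shows "DERIV f x :> D"
  using assms by (metis at_within_Icc_at)

text \<open>
  Eliminating \<open>A\<close> gives \<open>(s (1 - s) X')' = - k X\<close>. The factor \<open>A\<close> of \<open>s A = - s (1 - s) X'\<close> is used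
  because it is continuous at the singular end \<open>s = 0\<close>. Defining the angle of \<open>(X, s A)\<close> as the
  integral of its rate of change avoids choosing a branch.
\<close>

locale radial_system =
  fixes k X A :: "real \<Rightarrow> real"
  assumes X0: "X 0 = 1"
    and cont_k: "continuous_on {0..1/2} k"
    and cont_A: "continuous_on {0..1/2} A"
    and deriv_X: "s \<in> {0..1/2} \<Longrightarrow> (X has_real_derivative - A s / (1 - s)) (at s within {0..1/2})"
    and deriv_sA: "s \<in> {0..1/2} \<Longrightarrow>
      ((\<lambda>s. s * A s) has_real_derivative k s * X s) (at s within {0..1/2})"
begin

lemma cont_X: "continuous_on {0..1/2} X"
  by (rule DERIV_continuous_on[OF deriv_X])

definition radius2 :: "real \<Rightarrow> real" where "radius2 s = (X s)\<^sup>2 + (s * A s)\<^sup>2"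

text \<open>With \<open>x = X\<close> and \<open>y = s * A\<close> this is
  \<open>(x * y' - y * x') / (x\<^sup>2 + y\<^sup>2)\<close>, the derivative of the polar angle of
  \<open>(x, y)\<close>. Expressed through \<open>A\<close>, it has no singularity at
  \<open>s = 0\<close>.\<close>

definition rate :: "real \<Rightarrow> real" where
  "rate s = (k s * (X s)\<^sup>2 + s * (A s)\<^sup>2 / (1 - s)) / radius2 s"

definition angle :: "real \<Rightarrow> real" where "angle s = integral {0..s} rate"

text \<open>The component of \<open>(X, s * A)\<close> along the unit vector of direction
  \<open>angle s\<close>. It turns out to be the positive radius.\<close>

definition amp :: "real \<Rightarrow> real" where "amp s = X s * cos (angle s) + s * A s * sin (angle s)"

lemma radius2_deriv:
  assumes "s \<in> {0..1/2}"
  shows "(radius2 has_real_derivative 2 * (X s * (- A s / (1 - s)) + s * A s * (k s * X s))) (at s within {0..1/2})"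
  unfolding radius2_def
  by (rule derivative_eq_intros deriv_X[OF assms] deriv_sA[OF assms] refl)+ (simp add: algebra_simps)

lemma cont_radius2: "continuous_on {0..1/2} radius2"
  by (rule DERIV_continuous_on[OF radius2_deriv])

text \<open>Continuity keeps \<open>X\<close> positive close to 0, which gives a starting point
  \<delta> > 0. From \<delta> on the linear system is regular and the logarithmic derivative of
  \<open>radius2\<close> is bounded, so Gronwall excludes a zero.\<close>

lemma radius2_pos:
  assumes s: "s \<in> {0..1/2}"
  shows "radius2 s > 0"
proof (cases "s = 0")
  case True
  then show ?thesis by (simp add: radius2_def X0)
next
  case False
  obtain d where d: "d > 0" "\<And>x. x \<in> {0..1/2} \<Longrightarrow> dist x 0 < d \<Longrightarrow> dist (X x) (X 0) < 1"
    using cont_X[unfolded continuous_on_iff, rule_format, of 0 1] by auto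
  define \<delta> where "\<delta> = min (d / 2) s"
  have \<delta>: "0 < \<delta>" "\<delta> \<le> s" "\<delta> < d" using d False s by (auto simp: \<delta>_def)
  have "\<bar>X \<delta> - 1\<bar> < 1" using d(2)[of \<delta>] \<delta> s by (auto simp: dist_real_def X0)
  then have "radius2 \<delta> > 0" by (auto simp: radius2_def intro!: add_pos_nonneg)
  have "continuous_on {\<delta>..s} (\<lambda>r. \<bar>k r - 1 / (r * (1 - r))\<bar>)"
    using \<delta> s by (auto intro!: continuous_intros continuous_on_subset[OF cont_k])
  then have "bounded ((\<lambda>r. \<bar>k r - 1 / (r * (1 - r))\<bar>) ` {\<delta>..s})"
    by (intro compact_imp_bounded compact_continuous_image) auto
  then have "\<exists>C. \<forall>r\<in>{\<delta>..s}. \<bar>k r - 1 / (r * (1 - r))\<bar> \<le> C"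
    by (auto simp: bounded_iff)
  then obtain C where C: "\<And>r. r \<in> {\<delta>..s} \<Longrightarrow> \<bar>k r - 1 / (r * (1 - r))\<bar> \<le> C"
    by blast
  have "radius2 s \<ge> radius2 \<delta> * exp (- C * (s - \<delta>))"
  proof (rule gronwall_lower)
    show "continuous_on {\<delta>..s} radius2"
      using \<delta> s by (intro continuous_on_subset[OF cont_radius2]) auto
    fix r assume r: "\<delta> < r" "r < s"
    have "DERIV radius2 r :> 2 * (X r * (- A r / (1 - r)) + r * A r * (k r * X r))"
      using r \<delta> s by (intro DERIV_within_interior[OF radius2_deriv]) auto
    moreover have "2 * (X r * (- A r / (1 - r)) + r * A r * (k r * X r))
        = (2 * X r * (r * A r)) * (k r - 1 / (r * (1 - r)))"
      using r \<delta> s by (simp add: field_simps)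
    moreover have "\<bar>2 * X r * (r * A r)\<bar> \<le> radius2 r"
    proof -
      have "0 \<le> (X r - r * A r)\<^sup>2" "0 \<le> (X r + r * A r)\<^sup>2" by simp_all
      then show ?thesis unfolding radius2_def power2_eq_square by (simp only: abs_le_iff) (simp add: algebra_simps)
    qed
    then have "\<bar>(2 * X r * (r * A r)) * (k r - 1 / (r * (1 - r)))\<bar> \<le> radius2 r * C"
      unfolding abs_mult[of "2 * X r * (r * A r)"] using C[of r] r by (intro mult_mono) (auto simp: radius2_def)
    ultimately show "\<exists>y. DERIV radius2 r :> y \<and> - C * radius2 r \<le> y"
      by (intro exI conjI) (auto simp: abs_le_iff mult_ac)
  qed (use \<delta> in auto)
  then show ?thesis using \<open>radius2 \<delta> > 0\<close> by (auto intro: less_le_trans[rotated])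
qed

lemma cont_rate: "continuous_on {0..1/2} rate"
  unfolding rate_def using radius2_pos
  by (intro continuous_intros cont_k cont_X cont_A cont_radius2) (force)+

lemma angle_deriv: "s \<in> {0..1/2} \<Longrightarrow> (angle has_real_derivative rate s) (at s within {0..1/2})"
  unfolding angle_def by (rule integral_has_real_derivative[OF cont_rate])

lemma cont_angle: "continuous_on {0..1/2} angle"
  by (rule DERIV_continuous_on[OF angle_deriv])

lemma angle_0: "angle 0 = 0"
  by (simp add: angle_def)

text \<open>\<open>N\<close> is the component of \<open>(X, s * A)\<close> orthogonal to the
  direction \<open>angle s\<close>. The quotient of its square by \<open>radius2\<close> is the
  squared sine of the error between \<open>angle\<close> and the true polar angle; it has derivative
  0 and vanishes at \<open>s = 0\<close>.\<close>

lemma polar_aux: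
  assumes s: "s \<in> {0..1/2}"
  shows "X s * sin (angle s) = s * A s * cos (angle s)"
proof -
  define N where "N s = X s * sin (angle s) - s * A s * cos (angle s)" for s
  have "((\<lambda>s. (N s)\<^sup>2 / radius2 s) has_real_derivative 0) (at r within {0..1/2})"
    if r: "r \<in> {0..1/2}" for r
  proof -
    define X' Y' x y \<phi> R where "X' = - A r / (1 - r)" and "Y' = k r * X r"
      and "x = X r" and "y = r * A r" and "\<phi> = angle r" and "R = radius2 r"
    have R: "R = x\<^sup>2 + y\<^sup>2" "R > 0"
      using radius2_pos[OF r] by (auto simp: R_def radius2_def x_def y_def)
    have rate: "rate r * R = x * Y' - y * X'"
      using R(2) by (simp add: rate_def R_def x_def y_def X'_def Y'_def power2_eq_square)
    define DN where "DN = X' * sin \<phi> + x * (cos \<phi> * rate r) - (Y' * cos \<phi> - y * (sin \<phi> * rate r))"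
    have DN: "(N has_real_derivative DN) (at r within {0..1/2})"
      unfolding N_def DN_def X'_def Y'_def x_def y_def \<phi>_def
      by (rule derivative_eq_intros deriv_X[OF r] deriv_sA[OF r] angle_deriv[OF r] refl)+ (simp add: algebra_simps)
    have "R * DN = (X' * sin \<phi> - Y' * cos \<phi>) * R + (x * cos \<phi> + y * sin \<phi>) * (rate r * R)"
      by (simp add: DN_def algebra_simps)
    also have "\<dots> = (X' * sin \<phi> - Y' * cos \<phi>) * R + (x * cos \<phi> + y * sin \<phi>) * (x * Y' - y * X')"
      by (simp only: rate)
    also have "\<dots> = N r * (x * X' + y * Y')"
      unfolding R(1) N_def x_def[symmetric] y_def[symmetric] \<phi>_def[symmetric] by algebra
    finally have 1: "R * DN = N r * (x * X' + y * Y')" .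
    have DR: "(radius2 has_real_derivative 2 * (x * X' + y * Y')) (at r within {0..1/2})"
      using radius2_deriv[OF r] by (simp add: x_def y_def X'_def Y'_def)
    have "((\<lambda>s. (N s)\<^sup>2 / radius2 s) has_real_derivative
        ((2 * N r * DN) * R - (N r)\<^sup>2 * (2 * (x * X' + y * Y'))) / (R * R)) (at r within {0..1/2})"
      using R(2) unfolding R_def
      by (auto intro!: derivative_eq_intros DN DR simp: power2_eq_square)
    moreover have "(2 * N r * DN) * R - (N r)\<^sup>2 * (2 * (x * X' + y * Y')) = 0"
      using 1 by algebra
    ultimately show ?thesis by simp
  qed
  then obtain c where c: "\<And>s. s \<in> {0..1/2} \<Longrightarrow> (N s)\<^sup>2 / radius2 s = c"
    using has_field_derivative_zero_constant[of "{0..1/2}" "\<lambda>s. (N s)\<^sup>2 / radius2 s"] by auto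
  have "c = 0" using c[of 0] by (simp add: N_def angle_0)
  then have "N s = 0" using c[OF s] radius2_pos[OF s] by auto
  then show ?thesis by (simp add: N_def)
qed

lemma polar_X: "s \<in> {0..1/2} \<Longrightarrow> X s = amp s * cos (angle s)"
  and polar_sA: "s \<in> {0..1/2} \<Longrightarrow> s * A s = amp s * sin (angle s)"
  using polar_aux[of s] sin_cos_squared_add[of "angle s"] unfolding amp_def by algebra+

lemma amp_sq: "s \<in> {0..1/2} \<Longrightarrow> (amp s)\<^sup>2 = radius2 s"
  using polar_X[of s] polar_sA[of s] sin_cos_squared_add[of "angle s"] unfolding radius2_def by algebra

lemma amp_pos:
  assumes "s \<in> {0..1/2}"
  shows "amp s > 0"
proof (rule continuous_positive_by_first_exit[OF _ _ _ assms])
  show "continuous_on {0..1/2} amp"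
    unfolding amp_def by (intro continuous_intros cont_X cont_A cont_angle)
  show "amp 0 > 0" by (simp add: amp_def angle_0 X0)
  show "amp s \<noteq> 0" if "s \<in> {0..1/2}" for s
    using amp_sq[OF that] radius2_pos[OF that] by auto
qed

text \<open>The Pruefer equation: the amplitude cancels, so angles of different systems can be
  compared directly.\<close>

lemma rate_polar:
  assumes "s \<in> {0<..1/2}"
  shows "rate s = k s * (cos (angle s))\<^sup>2 + (sin (angle s))\<^sup>2 / (s * (1 - s))"
proof -
  have s: "s \<in> {0..1/2}" using assms by auto
  have "s * (A s)\<^sup>2 / (1 - s) = (s * A s)\<^sup>2 / (s * (1 - s))"
    using assms by (simp add: power2_eq_square)
  then show ?thesis
    unfolding rate_def polar_X[OF s] polar_sA[OF s] amp_sq[OF s, symmetric]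
    using amp_pos[OF s] by (simp add: power_mult_distrib add_divide_distrib)
qed

lemma rate_0: "rate 0 = k 0"
  by (simp add: rate_def radius2_def X0)

lemma angle_nonneg:
  assumes "\<And>s. s \<in> {0..1/2} \<Longrightarrow> k s \<ge> 0" and s: "s \<in> {0..1/2}"
  shows "angle s \<ge> 0"
  unfolding angle_def
proof (rule integral_nonneg)
  show "rate integrable_on {0..s}"
    using s by (intro integrable_continuous_real continuous_on_subset[OF cont_rate]) auto
  show "0 \<le> rate r" if "r \<in> {0..s}" for r
    using that s assms(1)[of r] by (auto simp: rate_def radius2_def intro!: divide_nonneg_nonneg add_nonneg_nonneg)
qed

lemma angle_strict_mono:
  assumes k: "\<And>s. s \<in> {0..1/2} \<Longrightarrow> k s > 0" and st: "s \<in> {0..1/2}" "t \<in> {0..1/2}" "s < t"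
  shows "angle s < angle t"
proof (rule DERIV_pos_imp_increasing_open[OF \<open>s < t\<close>])
  show "continuous_on {s..t} angle"
    using st by (intro continuous_on_subset[OF cont_angle]) auto
  fix r assume r: "s < r" "r < t"
  have r': "r \<in> {0<..1/2}" using r st by auto
  have "(cos (angle r))\<^sup>2 > 0 \<or> (sin (angle r))\<^sup>2 > 0"
    using sin_cos_squared_add[of "angle r"] by (metis add.right_neutral less_irrefl zero_less_one zero_less_power2 power_zero_numeral)
  moreover have "r * (1 - r) > 0" using r' by auto
  moreover have "k r > 0" using k r' by simp
  ultimately have "rate r > 0"
    unfolding rate_polar[OF r']
    by (elim disjE)
       (simp_all add: add_pos_nonneg add_nonneg_pos del: zero_less_power2)
  moreover have "DERIV angle r :> rate r"
    using r st by (intro DERIV_within_interior[OF angle_deriv]) auto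
  ultimately show "\<exists>y. DERIV angle r :> y \<and> y > 0" by blast
qed

end

section \<open>Sturm comparison and uniqueness from the singular end\<close>

lemma abs_sin_sq_diff_le:
  fixes a b :: real
  shows "\<bar>(sin a)\<^sup>2 - (sin b)\<^sup>2\<bar> \<le> \<bar>a - b\<bar>"
proof -
  have "(sin a)\<^sup>2 - (sin b)\<^sup>2 = sin (a - b) * sin (a + b)"
    unfolding sin_add sin_diff using sin_cos_squared_add[of a] sin_cos_squared_add[of b] by algebra
  also have "\<bar>\<dots>\<bar> \<le> \<bar>a - b\<bar> * 1"
    unfolding abs_mult by (intro mult_mono abs_sin_x_le_abs_x abs_sin_le_one) auto
  finally show ?thesis by simp
qed

text \<open>The Pruefer equation is singular at \<open>s = 0\<close>, so a Lipschitz estimate cannot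
  start there. The rates at 0 are \<open>\<mu>1 < \<mu>2\<close>, so the second angle takes the lead
  at once; from some \<delta> > 0 on, Gronwall keeps the lead positive.\<close>

lemma sturm_comparison:
  assumes sys1: "radial_system (\<lambda>_. \<mu>1) X1 A1" and sys2: "radial_system (\<lambda>_. \<mu>2) X2 A2"
    and \<mu>: "0 \<le> \<mu>1" "\<mu>1 < \<mu>2"
  shows "radial_system.angle (\<lambda>_. \<mu>1) X1 A1 (1/2) < radial_system.angle (\<lambda>_. \<mu>2) X2 A2 (1/2)"
proof -
  interpret s1: radial_system "\<lambda>_. \<mu>1" X1 A1 by (rule sys1)
  interpret s2: radial_system "\<lambda>_. \<mu>2" X2 A2 by (rule sys2)
  define D where "D s = s2.angle s - s1.angle s" for s
  have D': "(D has_real_derivative s2.rate s - s1.rate s) (at s within {0..1/2})" if "s \<in> {0..1/2}" for s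
    unfolding D_def using that by (intro derivative_intros s1.angle_deriv s2.angle_deriv)
  have "\<exists>d>0. \<forall>h>0. 0 + h \<in> {0..1/2} \<longrightarrow> h < d \<longrightarrow> D 0 < D (0 + h)"
    by (rule has_real_derivative_pos_inc_right[OF D'])
       (use \<mu> in \<open>auto simp: s1.rate_0 s2.rate_0\<close>)
  then obtain d where d: "d > 0" "\<And>h. 0 < h \<Longrightarrow> h \<le> 1/2 \<Longrightarrow> h < d \<Longrightarrow> D 0 < D h" by auto
  define \<delta> where "\<delta> = min (d / 2) (1/2)"
  have \<delta>: "0 < \<delta>" "\<delta> \<le> 1/2" "\<delta> < d" using d by (auto simp: \<delta>_def)
  have D\<delta>: "D \<delta> > 0" using d(2)[of \<delta>] \<delta> by (simp add: D_def s1.angle_0 s2.angle_0)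
  \<comment> \<open>Eliminating the cosines from the difference of the rates leaves
    \<open>(\<mu>2 - \<mu>1) * (cos a)\<^sup>2 \<ge> 0\<close> plus
    \<open>1 / (r * (1 - r)) - \<mu>1\<close> times the difference of the squared sines.
    \<open>C\<close> bounds this last coefficient, because
    \<open>r * (1 - r) \<ge> \<delta> / 2\<close>.\<close>
  define C where "C = \<mu>1 + 2 / \<delta>"
  have cD: "continuous_on {\<delta>..1/2} D"
    using \<delta> by (intro continuous_on_subset[OF DERIV_continuous_on[OF D']]) auto
  have "D (1/2) > 0"
  proof (rule continuous_positive_by_first_exit[OF cD])
    fix s assume s: "s \<in> {\<delta>..1/2}" and nn: "\<And>r. r \<in> {\<delta>..s} \<Longrightarrow> D r \<ge> 0"
    have "D s \<ge> D \<delta> * exp (- C * (s - \<delta>))"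
    proof (rule gronwall_lower)
      show "continuous_on {\<delta>..s} D" using s by (intro continuous_on_subset[OF cD]) auto
      fix r assume r: "\<delta> < r" "r < s"
      have r': "r \<in> {0<..1/2}" using r s \<delta> by auto
      have "DERIV D r :> s2.rate r - s1.rate r"
        using r s \<delta> by (intro DERIV_within_interior[OF D']) auto
      moreover have "s2.rate r - s1.rate r \<ge> - C * D r"
      proof -
        define q where "q = 1 / (r * (1 - r)) - \<mu>1"
        define a b where "a = s2.angle r" and "b = s1.angle r"
        have "\<delta> * (1/2) \<le> r * (1 - r)" using r s \<delta> by (intro mult_mono) auto
        then have "1 / (r * (1 - r)) \<le> 1 / (\<delta> * (1/2))"
          using \<delta> by (intro divide_left_mono) auto
        also have "\<dots> = 2 / \<delta>" by simp
        finally have "1 / (r * (1 - r)) \<le> 2 / \<delta>" .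
        moreover have "1 / (r * (1 - r)) \<ge> 0" "2 / \<delta> \<ge> 0" using r s \<delta> by auto
        ultimately have q: "\<bar>q\<bar> \<le> C" using \<mu> unfolding q_def C_def by linarith
        have "\<bar>q * ((sin a)\<^sup>2 - (sin b)\<^sup>2)\<bar> \<le> C * \<bar>a - b\<bar>"
          unfolding abs_mult using q by (intro mult_mono abs_sin_sq_diff_le) auto
        also have "\<bar>a - b\<bar> = D r" using nn[of r] r by (simp add: D_def a_def b_def)
        finally have "q * ((sin a)\<^sup>2 - (sin b)\<^sup>2) \<ge> - C * D r" by linarith
        moreover have "s2.rate r - s1.rate r = (\<mu>2 - \<mu>1) * (cos a)\<^sup>2 + q * ((sin a)\<^sup>2 - (sin b)\<^sup>2)"
          unfolding s1.rate_polar[OF r'] s2.rate_polar[OF r'] a_def[symmetric] b_def[symmetric] q_def cos_squared_eq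
          by (simp add: algebra_simps)
        moreover have "(\<mu>2 - \<mu>1) * (cos a)\<^sup>2 \<ge> 0" using \<mu> by simp
        ultimately show ?thesis by linarith
      qed
      ultimately show "\<exists>y. DERIV D r :> y \<and> - C * D r \<le> y" by blast
    qed (use s in auto)
    then show "D s \<noteq> 0" using D\<delta> by (smt (verit) exp_gt_zero mult_pos_pos)
  qed (use D\<delta> \<delta> in auto)
  then show ?thesis by (simp add: D_def)
qed

text \<open>At the singular end the value \<open>D 0\<close> alone determines the solution;
  continuity of \<open>B\<close> up to 0 replaces the second initial condition. This shows that the
  Legendre polynomial does not vanish at 1, and identifies the solution for
  \<open>e = 1\<close>.\<close>

lemma radial_uniqueness:
  fixes D B F :: "real \<Rightarrow> real"
  assumes D0: "D 0 = 0" and cB: "continuous_on {0..1/2} B"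
    and dD: "\<And>s. s \<in> {0..1/2} \<Longrightarrow> (D has_real_derivative - B s / (1 - s)) (at s within {0..1/2})"
    and dB: "\<And>s. s \<in> {0..1/2} \<Longrightarrow> ((\<lambda>s. s * B s) has_real_derivative F s) (at s within {0..1/2})"
    and F: "\<And>s. s \<in> {0..1/2} \<Longrightarrow> \<bar>F s\<bar> \<le> L * \<bar>D s\<bar>"
    and s: "s \<in> {0..1/2}"
  shows "D s = 0"
proof -
  \<comment> \<open>The derivative of the second term contains \<open>- 2 * (B r)\<^sup>2\<close>, which absorbs the mixed terms.\<close>
  define Q where "Q r = (D r)\<^sup>2 + 2 * r * (B r)\<^sup>2" for r
  define C where "C = 4 + 4 * L\<^sup>2"
  have cQ: "continuous_on {0..s} Q"
    unfolding Q_def using s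
    by (intro continuous_intros continuous_on_subset[OF cB] continuous_on_subset[OF DERIV_continuous_on[OF dD]]) auto
  have "- Q s \<ge> - Q 0 * exp (- (- C) * (s - 0))"
  proof (rule gronwall_lower)
    fix r assume r: "0 < r" "r < s"
    have dD': "DERIV D r :> - B r / (1 - r)" and dB': "DERIV (\<lambda>s. s * B s) r :> F r"
      using r s dD[of r] dB[of r] by (auto elim!: DERIV_within_interior)
    define Q' where "Q' = 2 * D r * (- B r / (1 - r)) + 2 * (2 * B r * F r - (B r)\<^sup>2)"
    have "DERIV (\<lambda>s. (s * B s)\<^sup>2) r :> 2 * (r * B r) * F r"
      using DERIV_power[OF dB', of 2] by (simp add: mult_ac)
    from DERIV_divide[OF this DERIV_ident]
    have *: "DERIV (\<lambda>s. (s * B s)\<^sup>2 / s) r :> 2 * (B r * F r) - (B r)\<^sup>2"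
      using r by (simp add: power2_eq_square diff_divide_distrib)
    have "DERIV (\<lambda>s. (D s)\<^sup>2 + 2 * ((s * B s)\<^sup>2 / s)) r :> Q'"
      using DERIV_add[OF DERIV_power[OF dD', of 2] DERIV_cmult[OF *, of 2]]
      unfolding Q'_def by (simp add: algebra_simps)
    then have "DERIV Q r :> Q'"
      by (rule has_field_derivative_transform_within_open[of _ _ _ "{0<..}"])
         (use r in \<open>auto simp: Q_def power2_eq_square\<close>)
    moreover have "Q' \<le> C * Q r"
    proof -
      define x y where "x = \<bar>D r\<bar>" and "y = \<bar>B r\<bar>"
      have "2 * D r * (- B r / (1 - r)) \<le> 2 * x * (y * 2)"
      proof -
        have "2 * D r * (- B r / (1 - r)) \<le> \<bar>2 * D r * (- B r / (1 - r))\<bar>" by (rule abs_ge_self)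
        also have "\<dots> = 2 * x * (y * (1 / (1 - r)))" using r s by (simp add: abs_mult x_def y_def)
        also have "\<dots> \<le> 2 * x * (y * 2)" using r s
          by (intro mult_left_mono) (auto simp: x_def y_def field_simps)
        finally show ?thesis .
      qed
      moreover have "4 * (B r * F r) \<le> 4 * (y * (L * x))"
      proof -
        have "B r * F r \<le> \<bar>B r\<bar> * \<bar>F r\<bar>" by (metis abs_ge_self abs_mult)
        also have "\<dots> \<le> y * (L * x)" unfolding x_def y_def using F[of r] r s by (intro mult_left_mono) auto
        finally show ?thesis by simp
      qed
      moreover have "4 * x * y \<le> 4 * x\<^sup>2 + y\<^sup>2" using zero_le_power2[of "2 * x - y"] by (simp add: power2_eq_square algebra_simps)
      moreover have "4 * (y * (L * x)) \<le> y\<^sup>2 + 4 * L\<^sup>2 * x\<^sup>2" using zero_le_power2[of "y - 2 * L * x"] by (simp add: power2_eq_square algebra_simps)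
      moreover have "(B r)\<^sup>2 = y\<^sup>2" "(D r)\<^sup>2 = x\<^sup>2" by (simp_all add: x_def y_def)
      moreover have "C * x\<^sup>2 \<le> C * Q r" using r by (intro mult_left_mono) (auto simp: Q_def x_def C_def)
      ultimately show ?thesis by (simp add: Q'_def C_def algebra_simps)
    qed
    ultimately show "\<exists>y. DERIV (\<lambda>r. - Q r) r :> y \<and> - (- C) * - Q r \<le> y"
      by (intro exI[of _ "- Q'"]) (auto intro!: derivative_intros)
  qed (use s cQ in \<open>auto intro!: continuous_intros\<close>)
  then have "Q s \<le> 0" by (simp add: Q_def D0)
  moreover have "2 * s * (B s)\<^sup>2 \<ge> 0" using s by auto
  ultimately show ?thesis unfolding Q_def by (smt (verit) zero_eq_power2 zero_le_power2)
qed

section \<open>Legendre polynomials of even degree\<close>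

text \<open>Even power series at \<open>z = 0\<close> for
  \<open>((1 - z\<^sup>2) p')' = - \<mu> p\<close>. The coefficient recursion stops at degree
  \<open>2 * j\<close> because its numerator is 0 for \<open>i = j\<close>. The normalisation is
  \<open>p 0 = 1\<close>, as the value at 1 is not yet known to be nonzero.\<close>

lemma even_legendre_polynomial:
  fixes j :: nat
  defines "\<mu> \<equiv> 2 * real j * (2 * real j + 1)"
  obtains p p' :: "real \<Rightarrow> real" where
    "\<And>z. (p has_real_derivative p' z) (at z)"
    "\<And>z. ((\<lambda>z. (1 - z\<^sup>2) * p' z) has_real_derivative - \<mu> * p z) (at z)"
    "p 0 = 1" "p' 0 = 0" "continuous_on UNIV p'"
proof -
  define b where "b = rec_nat 1 (\<lambda>i x. x * ((2 * real i * (2 * real i + 1) - \<mu>) / ((2 * real i + 1) * (2 * real i + 2))))"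
  have b0: "b 0 = 1" by (simp add: b_def)
  have "b (Suc i) = b i * ((2 * real i * (2 * real i + 1) - \<mu>) / ((2 * real i + 1) * (2 * real i + 2)))" for i
    by (simp add: b_def)
  then have bS: "(2 * real i + 2) * (2 * real i + 1) * b (Suc i) = b i * (2 * real i * (2 * real i + 1) - \<mu>)" for i
    by (simp add: divide_simps mult_ac)
  define p where "p z = (\<Sum>i\<le>j. b i * z ^ (2 * i))" for z
  define p' where "p' z = (\<Sum>i\<le>j. b i * (real (2 * i) * z ^ (2 * i - 1)))" for z
  define p'' where "p'' z = (\<Sum>i\<le>j. b i * (real (2 * i) * (real (2 * i - 1) * z ^ (2 * i - 2))))" for z
  have p: "(p has_real_derivative p' z) (at z)" for z
    unfolding p_def p'_def by (auto intro!: derivative_eq_intros sum.cong simp: mult_ac)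
  have p': "(p' has_real_derivative p'' z) (at z)" for z
    unfolding p''_def p'_def by (auto intro!: derivative_eq_intros sum.cong simp: numeral_2_eq_2 mult_ac)
  have zp': "z * p' z = (\<Sum>i\<le>j. b i * (2 * real i) * z ^ (2 * i))" for z
    unfolding p'_def sum_distrib_left
  proof (rule sum.cong)
    fix i show "z * (b i * (real (2 * i) * z ^ (2 * i - 1))) = b i * (2 * real i) * z ^ (2 * i)"
      by (cases i) auto
  qed simp
  have zp'': "z\<^sup>2 * p'' z = (\<Sum>i\<le>j. b i * (2 * real i * (2 * real i - 1)) * z ^ (2 * i))" for z
    unfolding p''_def sum_distrib_left
  proof (rule sum.cong)
    fix i show "z\<^sup>2 * (b i * (real (2 * i) * (real (2 * i - 1) * z ^ (2 * i - 2)))) = b i * (2 * real i * (2 * real i - 1)) * z ^ (2 * i)"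
      by (cases i) (auto simp: power2_eq_square)
  qed simp
  have p'': "p'' z = (\<Sum>i\<le>j. b i * (2 * real i * (2 * real i + 1) - \<mu>) * z ^ (2 * i))" for z
  proof -
    have "p'' z = (\<Sum>i<j. (2 * real i + 2) * (2 * real i + 1) * b (Suc i) * z ^ (2 * i))"
      unfolding p''_def by (subst sum.atMost_shift) (auto intro!: sum.cong simp: algebra_simps)
    \<comment> \<open>The term \<open>i = j\<close> can be added: its factor
      \<open>2 * real j * (2 * real j + 1) - \<mu>\<close> is 0.\<close>
    also have "\<dots> = (\<Sum>i<j. b i * (2 * real i * (2 * real i + 1) - \<mu>) * z ^ (2 * i))"
      unfolding bS ..
    also have "\<dots> = (\<Sum>i\<le>j. b i * (2 * real i * (2 * real i + 1) - \<mu>) * z ^ (2 * i))"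
      by (simp add: \<mu>_def flip: lessThan_Suc_atMost)
    finally show ?thesis .
  qed
  have eq: "- 2 * z * p' z + (1 - z\<^sup>2) * p'' z = - \<mu> * p z" for z
  proof -
    have "- 2 * z * p' z + (1 - z\<^sup>2) * p'' z = p'' z - z\<^sup>2 * p'' z - 2 * (z * p' z)"
      by (simp add: algebra_simps)
    also have "\<dots> = - \<mu> * p z"
      unfolding zp'' zp' unfolding p'' p_def sum_distrib_left
      by (simp add: algebra_simps flip: sum_subtractf)
    finally show ?thesis .
  qed
  show thesis
  proof (rule that[of p p'])
    show "((\<lambda>z. (1 - z\<^sup>2) * p' z) has_real_derivative - \<mu> * p z) (at z)" for z
      by (rule derivative_eq_intros p' refl)+ (use eq[of z] in \<open>simp add: algebra_simps\<close>)
    show "p 0 = 1"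
      unfolding p_def by (subst sum.atMost_shift) (simp add: b0)
    show "p' 0 = 0"
      unfolding p'_def by (intro sum.neutral) (auto simp: power_0_left)
    show "continuous_on UNIV p'"
      by (rule DERIV_continuous_on[OF has_field_derivative_at_within[OF p']])
  qed (rule p)
qed

text \<open>The substitution \<open>z = 1 - 2 * s\<close> sends \<open>z = 1\<close> to the singular
  end \<open>s = 0\<close> and the centre \<open>z = 0\<close> to \<open>s = 1/2\<close>, where
  \<open>A\<close> vanishes because \<open>p' 0 = 0\<close>. Dividing by \<open>p 1\<close> gives
  the initial value 1.\<close>

lemma even_legendre_system:
  obtains X A where "radial_system (\<lambda>_. 2 * real j * (2 * real j + 1)) X A" "A (1/2) = 0"
proof -
  define \<mu> where "\<mu> = 2 * real j * (2 * real j + 1)"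
  obtain p p' :: "real \<Rightarrow> real" where p: "\<And>z. (p has_real_derivative p' z) (at z)"
    and p': "\<And>z. ((\<lambda>z. (1 - z\<^sup>2) * p' z) has_real_derivative - \<mu> * p z) (at z)"
    and p0: "p 0 = 1" "p' 0 = 0" and cp': "continuous_on UNIV p'"
    using even_legendre_polynomial[of j] unfolding \<mu>_def by blast
  define D B where "D s = p (1 - 2 * s)" and "B s = 2 * (1 - s) * p' (1 - 2 * s)" for s
  have cB: "continuous_on {0..1/2} B"
    unfolding B_def by (intro continuous_intros continuous_on_compose2[OF cp']) auto
  have dD: "(D has_real_derivative - B s / (1 - s)) (at s within {0..1/2})" if "s \<in> {0..1/2}" for s
    unfolding D_def
    by (rule DERIV_chain2[OF p, THEN DERIV_cong] derivative_eq_intros refl)+ (use that in \<open>auto simp: B_def field_simps\<close>)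
  have dB: "((\<lambda>s. s * B s) has_real_derivative \<mu> * D s) (at s within {0..1/2})" for s
  proof -
    have "((\<lambda>s. 1/2 * ((1 - (1 - 2 * s)\<^sup>2) * p' (1 - 2 * s))) has_real_derivative 1/2 * (- \<mu> * p (1 - 2 * s) * (- 2))) (at s within {0..1/2})"
      by (intro DERIV_cmult DERIV_chain2[OF p', of "\<lambda>s. 1 - 2 * s"]) (auto intro!: derivative_eq_intros)
    moreover have "1/2 * ((1 - (1 - 2 * s)\<^sup>2) * p' (1 - 2 * s)) = s * B s" for s
      by (simp add: B_def power2_eq_square algebra_simps)
    ultimately show ?thesis by (simp add: D_def)
  qed
  \<comment> \<open>Otherwise \<open>D\<close> would start from 0 and vanish identically by
    uniqueness, against \<open>D (1/2) = p 0 = 1\<close>.\<close>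
  have "p 1 \<noteq> 0"
  proof
    assume "p 1 = 0"
    then have "D (1/2) = 0"
      using radial_uniqueness[OF _ cB dD dB, of \<mu> "1/2"]
      by (auto simp: D_def abs_mult \<mu>_def)
    then show False by (simp add: D_def p0)
  qed
  have "radial_system (\<lambda>_. \<mu>) (\<lambda>s. D s / p 1) (\<lambda>s. B s / p 1)"
  proof
    show "((\<lambda>s. D s / p 1) has_real_derivative - (B s / p 1) / (1 - s)) (at s within {0..1/2})"
      if "s \<in> {0..1/2}" for s
      using DERIV_cdivide[OF dD[OF that], of "p 1"] by (simp add: field_simps)
    show "((\<lambda>s. s * (B s / p 1)) has_real_derivative \<mu> * (D s / p 1)) (at s within {0..1/2})" for s
      using DERIV_cdivide[OF dB[of s], of "p 1"] by simp
  qed (use \<open>p 1 \<noteq> 0\<close> cB in \<open>auto simp: D_def intro!: continuous_intros\<close>)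
  then show thesis
    by (rule that[unfolded \<mu>_def[symmetric]]) (simp add: B_def p0)
qed

text \<open>No zeros are counted: the angles are multiples of \<open>pi\<close> and increase strictly with \<open>j\<close>.\<close>

lemma even_legendre_angle_ge:
  assumes "radial_system (\<lambda>_. 2 * real j * (2 * real j + 1)) X A" "A (1/2) = 0"
  shows "radial_system.angle (\<lambda>_. 2 * real j * (2 * real j + 1)) X A (1/2) \<ge> real j * pi"
  using assms
proof (induction j arbitrary: X A)
  case 0
  then interpret radial_system "\<lambda>_. 2 * real 0 * (2 * real 0 + 1)" X A by simp
  show ?case using angle_nonneg[of "1/2"] by simp
next
  case (Suc j)
  interpret radial_system "\<lambda>_. 2 * real (Suc j) * (2 * real (Suc j) + 1)" X A by (rule Suc.prems)
  obtain X0 A0 where *: "radial_system (\<lambda>_. 2 * real j * (2 * real j + 1)) X0 A0" "A0 (1/2) = 0"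
    by (rule even_legendre_system)
  have "real j * pi < angle (1/2)"
    by (rule le_less_trans[OF Suc.IH[OF *] sturm_comparison[OF *(1) Suc.prems(1)]])
       (auto simp: algebra_simps)
  moreover have "sin (angle (1/2)) = 0"
    using polar_sA[of "1/2"] amp_pos[of "1/2"] Suc.prems(2) by auto
  then obtain m :: int where m: "angle (1/2) = of_int m * pi"
    by (auto simp: sin_zero_iff_int2)
  ultimately have "of_int (int j) < (of_int m :: real)" by simp
  then have "int (Suc j) \<le> m" unfolding of_int_less_iff by simp
  then have "real (Suc j) \<le> of_int m" by (metis of_int_le_iff of_int_of_nat_eq)
  then show ?case unfolding m by (intro mult_right_mono) auto
qed

lemma linear_angle_gt:
  assumes "radial_system (\<lambda>_. \<mu>) X A" and "\<mu> > 2 * real n * (2 * real n + 1)"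
  shows "radial_system.angle (\<lambda>_. \<mu>) X A (1/2) > real n * pi"
proof -
  obtain X0 A0 where *: "radial_system (\<lambda>_. 2 * real n * (2 * real n + 1)) X0 A0" "A0 (1/2) = 0"
    by (rule even_legendre_system)
  show ?thesis
    by (rule le_less_trans[OF even_legendre_angle_ge[OF *] sturm_comparison[OF *(1) assms(1)]])
       (use assms in auto)
qed

section \<open>The nonlinear family\<close>

text \<open>
  \<open>secant \<mu>\<close> is the quotient of \<open>\<mu>/4 (w - w\<^sup>5)\<close> by \<open>1 - w\<close>. Clipping its argument makes
  \<open>x \<mapsto> secant \<mu> (clip (1 - e * x)) * x\<close> globally Lipschitz; \<open>profile_bounds\<close> shows that the clip
  is inactive on the solutions used.
\<close>

definition secant :: "real \<Rightarrow> real \<Rightarrow> real" where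
  "secant \<mu> w = \<mu> / 4 * (w * (1 + w) * (1 + w\<^sup>2))"

definition clip :: "real \<Rightarrow> real" where
  "clip w = max 0 (min 2 w)"

lemma clip_mem: "clip w \<in> {0..2}"
  by (auto simp: clip_def)

lemma clip_id: "w \<in> {0..2} \<Longrightarrow> clip w = w"
  by (auto simp: clip_def)

lemma secant_eq: "secant \<mu> w * (1 - w) = \<mu> / 4 * (w - w ^ 5)"
proof -
  have "w * (1 + w) * (1 + w\<^sup>2) * (1 - w) = w - w ^ 5"
    by (simp add: power2_eq_square power_numeral_reduce algebra_simps)
  then show ?thesis unfolding secant_def by (metis mult.assoc)
qed

lemma secant_bound:
  assumes "\<mu> > 0" "w \<in> {0..2}"
  shows "\<bar>secant \<mu> w\<bar> \<le> 8 * \<mu>"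
proof -
  have "w\<^sup>2 \<le> 2\<^sup>2" using assms by (intro power_mono) auto
  then have "w * (1 + w) * (1 + w\<^sup>2) \<le> 2 * 3 * 5"
    using assms by (intro mult_mono) auto
  moreover have "w * (1 + w) * (1 + w\<^sup>2) \<ge> 0" using assms by auto
  ultimately have "\<bar>w * (1 + w) * (1 + w\<^sup>2)\<bar> \<le> 30" by simp
  then have "\<mu> / 4 * \<bar>w * (1 + w) * (1 + w\<^sup>2)\<bar> \<le> \<mu> / 4 * 30"
    using assms by (intro mult_left_mono) auto
  then show ?thesis using assms unfolding secant_def abs_mult[of "\<mu> / 4"] by simp
qed

lemma secant_lipschitz:
  assumes "\<mu> > 0" "v \<in> {0..2}" "w \<in> {0..2}"
  shows "\<bar>secant \<mu> v - secant \<mu> w\<bar> \<le> 16 * \<mu> * \<bar>v - w\<bar>"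
proof -
  have "norm (secant \<mu> v - secant \<mu> w) \<le> 16 * \<mu> * norm (v - w)"
  proof (rule field_differentiable_bound[of "{0..2}"])
    fix z :: real assume z: "z \<in> {0..2}"
    show "(secant \<mu> has_field_derivative \<mu> / 4 * (1 + 2 * z + 3 * z\<^sup>2 + 4 * z ^ 3)) (at z within {0..2})"
      unfolding secant_def
      by (rule derivative_eq_intros refl)+ (simp add: power2_eq_square power3_eq_cube algebra_simps)
    have "z\<^sup>2 \<le> 2\<^sup>2" "z ^ 3 \<le> 2 ^ 3" using z by (intro power_mono; auto)+
    then have "1 + 2 * z + 3 * z\<^sup>2 + 4 * z ^ 3 \<le> 64" using z by auto
    moreover have "1 + 2 * z + 3 * z\<^sup>2 + 4 * z ^ 3 \<ge> 0" using z by auto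
    ultimately have "\<mu> / 4 * \<bar>1 + 2 * z + 3 * z\<^sup>2 + 4 * z ^ 3\<bar> \<le> \<mu> / 4 * 64"
      using assms by (intro mult_left_mono) auto
    then show "norm (\<mu> / 4 * (1 + 2 * z + 3 * z\<^sup>2 + 4 * z ^ 3)) \<le> 16 * \<mu>"
      using assms unfolding real_norm_def abs_mult[of "\<mu> / 4"] by simp
  qed (use assms in auto)
  then show ?thesis by simp
qed

text \<open>The factor \<open>\<bar>y\<bar>\<close> is unbounded, but clipping compensates. If
  \<open>e * \<bar>y\<bar> \<le> 1\<close>, the factor \<open>e\<close> in the arguments absorbs it.
  Otherwise, for equal signs both arguments are clipped to the same end, and for opposite signs
  \<open>\<bar>x - y\<bar> = \<bar>x\<bar> + \<bar>y\<bar>\<close>, which is at least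
  \<open>2 * \<bar>y\<bar>\<close>.\<close>

lemma clip_scaled_diff:
  assumes e: "e \<in> {0..1}" and le: "\<bar>y\<bar> \<le> \<bar>x\<bar>"
  shows "\<bar>y\<bar> * \<bar>clip (1 - e * x) - clip (1 - e * y)\<bar> \<le> \<bar>x - y\<bar>"
proof (cases "e * \<bar>y\<bar> \<le> 1")
  case True
  have "\<bar>clip (1 - e * x) - clip (1 - e * y)\<bar> \<le> \<bar>e * (x - y)\<bar>"
    by (simp add: clip_def right_diff_distrib)
  then have "\<bar>y\<bar> * \<bar>clip (1 - e * x) - clip (1 - e * y)\<bar> \<le> \<bar>y\<bar> * \<bar>e * (x - y)\<bar>"
    by (intro mult_left_mono) auto
  also have "\<dots> = (e * \<bar>y\<bar>) * \<bar>x - y\<bar>" using e by (simp add: abs_mult)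
  also have "\<dots> \<le> 1 * \<bar>x - y\<bar>" using True by (intro mult_right_mono) auto
  finally show ?thesis by simp
next
  case False
  have ex: "e * \<bar>y\<bar> \<le> e * \<bar>x\<bar>" using le e by (intro mult_left_mono) auto
  show ?thesis
  proof (cases "x * y > 0")
    case True
    then consider "x > 0" "y > 0" | "x < 0" "y < 0" by (auto simp: zero_less_mult_iff)
    then have "clip (1 - e * x) = clip (1 - e * y)"
      using False ex by cases (auto simp: clip_def)
    then show ?thesis by simp
  next
    case False
    then have "\<bar>x - y\<bar> = \<bar>x\<bar> + \<bar>y\<bar>" by (auto simp: not_less mult_le_0_iff)
    moreover have "\<bar>clip (1 - e * x) - clip (1 - e * y)\<bar> \<le> 2"
      using clip_mem[of "1 - e * x"] clip_mem[of "1 - e * y"] by auto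
    then have "\<bar>y\<bar> * \<bar>clip (1 - e * x) - clip (1 - e * y)\<bar> \<le> \<bar>y\<bar> * 2" by (intro mult_left_mono) auto
    ultimately show ?thesis using le by linarith
  qed
qed

lemma truncated_lipschitz:
  assumes \<mu>: "\<mu> > 0" and e: "e \<in> {0..1}"
  shows "\<bar>secant \<mu> (clip (1 - e * x)) * x - secant \<mu> (clip (1 - e * y)) * y\<bar> \<le> 24 * \<mu> * \<bar>x - y\<bar>"
proof -
  define k where "k z = secant \<mu> (clip (1 - e * z))" for z
  \<comment> \<open>In the splitting of the product, the argument of smaller modulus has to multiply
    the difference of the secants, as \<open>clip_scaled_diff\<close> demands. The constant is 8 +
    16 from the bound and the Lipschitz constant of \<open>secant\<close>.\<close>
  have wlog: "\<bar>k x * x - k y * y\<bar> \<le> 24 * \<mu> * \<bar>x - y\<bar>" if le: "\<bar>y\<bar> \<le> \<bar>x\<bar>" for x y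
  proof -
    have "k x * x - k y * y = k x * (x - y) + y * (k x - k y)" by (simp add: algebra_simps)
    then have "\<bar>k x * x - k y * y\<bar> \<le> \<bar>k x\<bar> * \<bar>x - y\<bar> + \<bar>y\<bar> * \<bar>k x - k y\<bar>"
      by (metis abs_mult abs_triangle_ineq)
    also have "\<bar>k x\<bar> * \<bar>x - y\<bar> \<le> 8 * \<mu> * \<bar>x - y\<bar>"
      unfolding k_def by (intro mult_right_mono secant_bound \<mu> clip_mem) auto
    also have "\<bar>y\<bar> * \<bar>k x - k y\<bar> \<le> \<bar>y\<bar> * (16 * \<mu> * \<bar>clip (1 - e * x) - clip (1 - e * y)\<bar>)"
      unfolding k_def by (intro mult_left_mono secant_lipschitz \<mu> clip_mem) auto
    also have "\<dots> = 16 * \<mu> * (\<bar>y\<bar> * \<bar>clip (1 - e * x) - clip (1 - e * y)\<bar>)" by simp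
    also have "\<dots> \<le> 16 * \<mu> * \<bar>x - y\<bar>"
      using \<mu> by (intro mult_left_mono clip_scaled_diff e le) auto
    finally show ?thesis by (simp add: algebra_simps)
  qed
  show ?thesis
    using wlog[of y x] wlog[of x y] unfolding k_def
    by (cases "\<bar>y\<bar> \<le> \<bar>x\<bar>") (auto simp: abs_minus_commute)
qed

section \<open>Energy bounds and the shooting argument\<close>

lemma profile_bounds:
  assumes \<mu>: "\<mu> > 0" and W0: "0 < W 0" "W 0 < 1" and ca: "continuous_on {0..1/2} a"
    and dW: "\<And>s. s \<in> {0..1/2} \<Longrightarrow> (W has_real_derivative a s / (1 - s)) (at s within {0..1/2})"
    and da: "\<And>s. s \<in> {0..1/2} \<Longrightarrow>
      ((\<lambda>s. s * a s) has_real_derivative secant \<mu> (clip (W s)) * (1 - W s)) (at s within {0..1/2})"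
    and s: "s \<in> {0..1/2}"
  shows "0 < W s \<and> W s < 3/2"
proof -
  \<comment> \<open>\<open>E\<close> is the energy, in which \<open>s * (a s)\<^sup>2 / (1 - s) = s * (1 - s) * (W' s)\<^sup>2\<close>. It decreases from
    \<open>E 0 < 0\<close>, whereas it would be nonnegative if \<open>W\<close> reached \<open>0\<close> or \<open>3/2\<close>.\<close>
  define G where "G w = \<mu> / 4 * (w\<^sup>2 / 2 - w ^ 6 / 6)" for w :: real
  define E where "E s = s * (a s)\<^sup>2 / (2 * (1 - s)) - G (W s)" for s
  have dG: "DERIV G w :> \<mu> / 4 * (w - w ^ 5)" for w
    unfolding G_def by (auto intro!: derivative_eq_intros)
  have cW: "continuous_on {0..1/2} W" by (rule DERIV_continuous_on[OF dW])
  have cE: "continuous_on {0..1/2} E"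
    unfolding E_def G_def by (intro continuous_intros ca cW) auto
  have "W s * (3/2 - W s) > 0"
  proof (rule continuous_positive_by_first_exit[OF _ _ _ s, where f = "\<lambda>s. W s * (3/2 - W s)"])
    show "continuous_on {0..1/2} (\<lambda>s. W s * (3/2 - W s))" by (intro continuous_intros cW)
    show "W 0 * (3/2 - W 0) > 0" using W0 by simp
    fix s assume s: "s \<in> {0..1/2}" and nn: "\<And>r. r \<in> {0..s} \<Longrightarrow> W r * (3/2 - W r) \<ge> 0"
    have range: "0 \<le> W r \<and> W r \<le> 3/2" if "r \<in> {0..s}" for r
      using nn[OF that] by (auto simp: zero_le_mult_iff)
    have "E s \<le> E 0"
    proof (rule DERIV_nonpos_imp_decreasing_open[where f = E and a = 0 and b = s])
      show "continuous_on {0..s} E" using s by (intro continuous_on_subset[OF cE]) auto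
      fix r assume r: "0 < r" "r < s"
      define m p g where "m = r * a r" and "p = r * (1 - r)" and "g = \<mu> / 4 * (W r - W r ^ 5)"
      have p: "p > 0" using r s by (auto simp: p_def)
      have dW': "DERIV W r :> m / p"
        using r s DERIV_within_interior[OF dW, of r] by (simp add: m_def p_def)
      have dm: "DERIV (\<lambda>s. s * a s) r :> g"
        using DERIV_within_interior[OF da, of r] r s range[of r]
        by (simp add: clip_id secant_eq g_def)
      have dp: "DERIV (\<lambda>s. 2 * (s * (1 - s))) r :> 2 * (1 - 2 * r)"
        by (auto intro!: derivative_eq_intros)
      have dGW: "DERIV (\<lambda>s. G (W s)) r :> g * (m / p)"
        using DERIV_chain2[OF dG dW'] by (simp add: g_def)
      have "DERIV (\<lambda>s. (s * a s)\<^sup>2 / (2 * (s * (1 - s))) - G (W s)) r :>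
          (2 * m * g * (2 * p) - m\<^sup>2 * (2 * (1 - 2 * r))) / ((2 * p) * (2 * p)) - g * (m / p)"
        by (rule DERIV_cong[OF DERIV_diff[OF DERIV_divide[OF DERIV_power[OF dm, of 2] dp] dGW]])
           (use p in \<open>auto simp: m_def p_def mult_ac\<close>)
      also have "(2 * m * g * (2 * p) - m\<^sup>2 * (2 * (1 - 2 * r))) / ((2 * p) * (2 * p)) - g * (m / p)
          = - (m\<^sup>2 * (1 - 2 * r) / (2 * p\<^sup>2))"
        using p by (simp add: power2_eq_square field_simps)
      finally have "DERIV (\<lambda>s. (s * a s)\<^sup>2 / (2 * (s * (1 - s))) - G (W s)) r :> - (m\<^sup>2 * (1 - 2 * r) / (2 * p\<^sup>2))" .
      then have "DERIV E r :> - (m\<^sup>2 * (1 - 2 * r) / (2 * p\<^sup>2))"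
        by (rule has_field_derivative_transform_within_open[of _ _ _ "{0<..}"])
           (use r in \<open>auto simp: E_def power2_eq_square\<close>)
      \<comment> \<open>The energy decreases because \<open>1 - 2 * r\<close> is nonnegative, that
        is, because the interval stops at 1/2.\<close>
      moreover have "- (m\<^sup>2 * (1 - 2 * r) / (2 * p\<^sup>2)) \<le> 0" using r s by auto
      ultimately show "\<exists>y. DERIV E r :> y \<and> y \<le> 0" by blast
    qed (use s in auto)
    moreover have "E s \<ge> - G (W s)" using s by (simp add: E_def)
    moreover have "G (W 0) > 0"
    proof -
      have "(W 0) ^ 4 < 1" using W0 by (simp add: power_less_one_iff)
      then have "\<mu> / 24 * ((W 0)\<^sup>2 * (3 - (W 0) ^ 4)) > 0" using \<mu> W0 by (intro mult_pos_pos) auto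
      then show ?thesis by (simp add: G_def power2_eq_square power_numeral_reduce algebra_simps)
    qed
    ultimately have "G (W s) > 0" by (simp add: E_def)
    \<comment> \<open>\<open>G w\<close> is \<open>\<mu> / 24 * (w\<^sup>2 * (3 - w ^ 4))\<close>,
      and 3/2 is beyond its positive zero since \<open>(3/2) ^ 4 = 81/16 > 3\<close>.\<close>
    moreover have "G 0 = 0" "G (3/2) < 0" using \<mu> by (simp_all add: G_def power_divide)
    ultimately have "W s \<noteq> 0" "W s \<noteq> 3/2" by (metis less_irrefl, metis less_asym)
    then show "W s * (3/2 - W s) \<noteq> 0" by simp
  qed
  then show ?thesis by (auto simp: zero_less_mult_iff)
qed

text \<open>Intermediate value theorem for the final angle \<open>\<Theta> e\<close>, which exceeds
  \<open>n * pi\<close> at \<open>e = 0\<close> and is 0 at \<open>e = 1\<close>. The factorisation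
  of \<open>s * a s\<close> gives the sign of the derivative of \<open>W\<close>; the integral
  formula for \<open>a\<close> serves to differentiate \<open>a\<close> up to
  \<open>s = 0\<close>.\<close>

lemma half_profile_exists:
  fixes n j :: nat
  assumes \<mu>: "\<mu> > 2 * real n * (2 * real n + 1)" and j: "1 \<le> j" "j \<le> n"
  obtains W a \<phi> q :: "real \<Rightarrow> real" where
    "W 0 < 1" "\<And>s. s \<in> {0..1/2} \<Longrightarrow> W s > 0" "continuous_on {0..1/2} a"
    "\<And>s. s \<in> {0..1/2} \<Longrightarrow> a s = integral {0..1} (\<lambda>\<tau>. \<mu> / 4 * (W (s * \<tau>) - W (s * \<tau>) ^ 5))"
    "\<And>s. s \<in> {0..1/2} \<Longrightarrow> (W has_real_derivative a s / (1 - s)) (at s within {0..1/2})"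
    "continuous_on {0..1/2} \<phi>" "strict_mono_on {0..1/2} \<phi>" "\<phi> 0 = 0" "\<phi> (1/2) = real j * pi"
    "\<And>s. s \<in> {0..1/2} \<Longrightarrow> q s > 0" "\<And>s. s \<in> {0..1/2} \<Longrightarrow> s * a s = q s * sin (\<phi> s)"
proof -
  have \<mu>0: "\<mu> > 0" using \<mu> by (rule le_less_trans[rotated]) auto
  define H where "H e x = secant \<mu> (clip (1 - e * x)) * x" for e x
  have cH: "continuous_on ({0..1} \<times> UNIV) (\<lambda>(e, x). H e x)"
    unfolding H_def secant_def clip_def case_prod_beta by (intro continuous_intros)
  have lip: "\<bar>H e x - H e y\<bar> \<le> 24 * \<mu> * \<bar>x - y\<bar>" if "e \<in> {0..1}" for e x y
    unfolding H_def by (rule truncated_lipschitz[OF \<mu>0 that])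
  have L: "24 * \<mu> > 0" using \<mu>0 by simp
  obtain X A where
      cX: "continuous_on ({0..1} \<times> {0..1/2}) (\<lambda>(e, s). X e s)"
    and cA: "continuous_on ({0..1} \<times> {0..1/2}) (\<lambda>(e, s). A e s)"
    and A: "\<And>e s. e \<in> {0..1} \<Longrightarrow> s \<in> {0..1/2} \<Longrightarrow> A e s = integral {0..1} (\<lambda>\<tau>. H e (X e (s * \<tau>)))"
    and X: "\<And>e s. e \<in> {0..1} \<Longrightarrow> s \<in> {0..1/2} \<Longrightarrow>
        X e s = 1 - s * integral {0..1} (\<lambda>\<tau>. A e (s * \<tau>) / (1 - s * \<tau>))"
    by (rule radial_family_exists[OF cH lip L], assumption, rule that)
  define k where "k e s = secant \<mu> (clip (1 - e * X e s))" for e s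
  have slice: "continuous_on {0..1/2} (f e)" if "continuous_on ({0..1} \<times> {0..1/2}) (\<lambda>(e, s). f e s)" "e \<in> {0..1}"
    for f :: "real \<Rightarrow> real \<Rightarrow> real" and e
    by (rule continuous_on_compose2[OF that(1), of _ "\<lambda>s. (e, s)", simplified])
       (use that(2) in \<open>auto intro!: continuous_intros\<close>)
  have ck: "continuous_on ({0..1} \<times> {0..1/2}) (\<lambda>(e, s). k e s)"
    using cX unfolding k_def secant_def clip_def case_prod_beta by (intro continuous_intros)
  have sys: "radial_system (k e) (X e) (A e)" if e: "e \<in> {0..1}" for e
  proof
    show "X e 0 = 1" using X[OF e, of 0] by simp
    show "continuous_on {0..1/2} (k e)" "continuous_on {0..1/2} (A e)"
      using slice[OF ck e] slice[OF cA e] by auto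
    fix s :: real assume s: "s \<in> {0..1/2}"
    have c: "continuous_on {0..1/2} (\<lambda>s. A e s / (1 - s))"
      using slice[OF cA e] by (intro continuous_intros) auto
    have "((\<lambda>s. 1 - s * integral {0..1} (\<lambda>\<tau>. A e (s * \<tau>) / (1 - s * \<tau>))) has_real_derivative 0 - A e s / (1 - s)) (at s within {0..1/2})"
      by (intro DERIV_diff DERIV_const mean_has_derivative[OF c s])
    then have "(X e has_real_derivative 0 - A e s / (1 - s)) (at s within {0..1/2})"
      by (rule has_field_derivative_transform_within[OF _ zero_less_one s]) (rule X[OF e, symmetric])
    then show "(X e has_real_derivative - A e s / (1 - s)) (at s within {0..1/2})" by simp
    have "continuous_on {0..1/2} (\<lambda>s. H e (X e s))"
      using slice[OF ck e] slice[OF cX e] unfolding H_def k_def by (intro continuous_intros)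
    from mean_has_derivative[OF this s]
    have "((\<lambda>s. s * A e s) has_real_derivative H e (X e s)) (at s within {0..1/2})"
      by (rule has_field_derivative_transform_within[OF _ zero_less_one s]) (simp only: A[OF e])
    then show "((\<lambda>s. s * A e s) has_real_derivative k e s * X e s) (at s within {0..1/2})"
      by (simp only: H_def k_def)
  qed
  define \<Theta> where "\<Theta> e = radial_system.angle (k e) (X e) (A e) (1/2)" for e
  have "continuous_on {0..1} \<Theta>"
  proof -
    have nz: "(X e s)\<^sup>2 + (s * A e s)\<^sup>2 \<noteq> 0" if "e \<in> {0..1}" "s \<in> {0..1/2}" for e s
      using radial_system.radius2_pos[OF sys[OF that(1)] that(2)]
      unfolding radial_system.radius2_def[OF sys[OF that(1)]] by (rule less_imp_neq[symmetric])
    have "continuous_on ({0..1} \<times> {0..1/2}) (\<lambda>(e, s). (k e s * (X e s)\<^sup>2 + s * (A e s)\<^sup>2 / (1 - s)) / ((X e s)\<^sup>2 + (s * A e s)\<^sup>2))"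
      using ck cX cA unfolding case_prod_beta by (intro continuous_intros) (use nz in auto)
    then have "continuous_on {0..1} (\<lambda>e. integral {0..1/2} (\<lambda>s. (k e s * (X e s)\<^sup>2 + s * (A e s)\<^sup>2 / (1 - s)) / ((X e s)\<^sup>2 + (s * A e s)\<^sup>2)))"
      using integral_continuous_on_param[of "{0..1}" "0::real" "1/2" "\<lambda>e s. (k e s * (X e s)\<^sup>2 + s * (A e s)\<^sup>2 / (1 - s)) / ((X e s)\<^sup>2 + (s * A e s)\<^sup>2)"]
      by simp
    moreover have "integral {0..1/2} (\<lambda>s. (k e s * (X e s)\<^sup>2 + s * (A e s)\<^sup>2 / (1 - s)) / ((X e s)\<^sup>2 + (s * A e s)\<^sup>2)) = \<Theta> e"
      if "e \<in> {0..1}" for e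
      unfolding \<Theta>_def radial_system.angle_def[OF sys[OF that]]
        radial_system.rate_def[OF sys[OF that]] radial_system.radius2_def[OF sys[OF that]] ..
    ultimately show ?thesis by (rule continuous_on_eq)
  qed
  \<comment> \<open>For \<open>e = 0\<close> the secant is evaluated at 1, and
    \<open>secant \<mu> 1 = \<mu>\<close>, so the system is the linear one.\<close>
  moreover have \<Theta>0: "\<Theta> 0 > real n * pi"
  proof -
    have "k 0 = (\<lambda>_. \<mu>)" by (auto simp: k_def secant_def clip_def)
    then show ?thesis using linear_angle_gt[OF _ \<mu>] sys[of 0] unfolding \<Theta>_def by simp
  qed
  moreover have \<Theta>1: "\<Theta> 1 = 0"
  proof -
    interpret s1: radial_system "k 1" "X 1" "A 1" by (rule sys) simp
    have X1: "X 1 s - 1 = 0" if "s \<in> {0..1/2}" for s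
    proof (rule radial_uniqueness[OF _ s1.cont_A _ s1.deriv_sA _ that])
      show "((\<lambda>s. X 1 s - 1) has_real_derivative - A 1 s / (1 - s)) (at s within {0..1/2})" if "s \<in> {0..1/2}" for s
        using DERIV_diff[OF s1.deriv_X[OF that] DERIV_const] by simp
      \<comment> \<open>\<open>H 1 1 = 0\<close> because \<open>secant \<mu> 0 = 0\<close>; the
        Lipschitz bound therefore compares \<open>X 1\<close> with the constant solution 1, that is,
        \<open>W = 0\<close>.\<close>
      show "\<bar>k 1 s * X 1 s\<bar> \<le> 24 * \<mu> * \<bar>X 1 s - 1\<bar>" for s
        using lip[of 1 "X 1 s" 1] by (simp add: H_def k_def secant_def clip_def)
    qed (simp add: s1.X0)
    have X1': "X 1 s = 1" if "s \<in> {0..1/2}" for s using X1[OF that] by simp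
    have A1: "A 1 s = 0" if s: "s \<in> {0..1/2}" for s
    proof -
      have "H 1 (X 1 (s * t)) = 0" if "t \<in> {0..1}" for t
        using X1'[OF mult_mem_interval[OF s that]] by (simp add: H_def secant_def clip_def)
      then have "integral {0..1} (\<lambda>t. H 1 (X 1 (s * t))) = integral {0..1} (\<lambda>t::real. 0::real)"
        by (intro integral_cong) auto
      then show ?thesis using A[of 1 s] s by simp
    qed
    have "s1.angle (1/2) = integral {0..1/2} (\<lambda>s::real. 0::real)"
      unfolding s1.angle_def s1.rate_def
      by (intro integral_cong) (auto simp: A1 k_def X1' secant_def clip_def)
    then show ?thesis by (simp add: \<Theta>_def)
  qed
  moreover have jn: "real j * pi \<le> real n * pi" using j by (intro mult_right_mono) auto
  moreover have "real j * pi \<le> \<Theta> 0" using jn \<Theta>0 by linarith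
  ultimately have "\<exists>e\<ge>0. e \<le> 1 \<and> \<Theta> e = real j * pi"
    by (intro IVT2') auto
  then obtain e where e: "0 \<le> e" "e \<le> 1" "\<Theta> e = real j * pi"
    by blast
  \<comment> \<open>Excluding both ends yields \<open>0 < W 0 < 1\<close>. The end 0 is excluded by
    the strict bound on \<open>\<Theta> 0\<close>, the end 1 by \<open>j \<ge> 1\<close>.\<close>
  have "e \<noteq> 0" using \<Theta>0 jn e by auto
  moreover have "e \<noteq> 1" using \<Theta>1 j e by auto
  ultimately have e01: "0 < e" "e < 1" using e by auto
  then have e': "e \<in> {0..1}" by auto
  interpret radial_system "k e" "X e" "A e" by (rule sys[OF e'])
  define W a where "W s = 1 - e * X e s" and "a s = e * A e s" for s
  have W0: "W 0 = 1 - e" by (simp add: W_def X0)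
  have ca: "continuous_on {0..1/2} a" unfolding a_def by (intro continuous_intros cont_A)
  have dW: "(W has_real_derivative a s / (1 - s)) (at s within {0..1/2})" if "s \<in> {0..1/2}" for s
    using DERIV_diff[OF DERIV_const[of 1] DERIV_cmult[OF deriv_X[OF that], of e]]
    by (simp add: W_def[abs_def] a_def)
  have da: "((\<lambda>s. s * a s) has_real_derivative secant \<mu> (clip (W s)) * (1 - W s)) (at s within {0..1/2})"
    if "s \<in> {0..1/2}" for s
    using DERIV_cmult[OF deriv_sA[OF that], of e]
    by (simp add: W_def a_def k_def mult_ac)
  have W: "0 < W s \<and> W s < 3/2" if "s \<in> {0..1/2}" for s
    by (rule profile_bounds[OF \<mu>0 _ _ ca dW da that]) (use e01 W0 in auto)
  \<comment> \<open>Positivity of \<open>W\<close> makes the coefficient positive, and hence the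
    angle strictly increasing.\<close>
  have k_pos: "k e s > 0" if "s \<in> {0..1/2}" for s
    using W[OF that] \<mu>0 clip_id[of "W s"]
    by (auto simp: k_def W_def[symmetric] secant_def intro!: mult_pos_pos add_pos_nonneg)
  show thesis
  proof (rule that[of W a angle "\<lambda>s. e * amp s"])
    fix s :: real assume s: "s \<in> {0..1/2}"
    have "a s = integral {0..1} (\<lambda>\<tau>. e * H e (X e (s * \<tau>)))"
      using A[OF e' s] by (simp add: a_def)
    also have "\<dots> = integral {0..1} (\<lambda>\<tau>. \<mu> / 4 * (W (s * \<tau>) - W (s * \<tau>) ^ 5))"
    proof (rule integral_cong)
      fix t :: real assume "t \<in> {0..1}"
      from W[OF mult_mem_interval[OF s this]] have "clip (W (s * t)) = W (s * t)"
        by (intro clip_id) auto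
      then have "e * H e (X e (s * t)) = secant \<mu> (W (s * t)) * (1 - W (s * t))"
        by (simp add: H_def W_def)
      then show "e * H e (X e (s * t)) = \<mu> / 4 * (W (s * t) - W (s * t) ^ 5)"
        by (simp only: secant_eq)
    qed
    finally show "a s = integral {0..1} (\<lambda>\<tau>. \<mu> / 4 * (W (s * \<tau>) - W (s * \<tau>) ^ 5))" .
    show "s * a s = e * amp s * sin (angle s)"
      using polar_sA[OF s] by (simp add: a_def)
  qed (use W W0 e01 e ca dW cont_angle angle_strict_mono[OF k_pos] amp_pos
      in \<open>auto simp: \<Theta>_def angle_0 strict_mono_on_def\<close>)
qed

section \<open>Reflection at the equator\<close>

lemma has_real_derivative_glue:
  fixes f g :: "real \<Rightarrow> real"
  assumes f: "\<And>x. x \<in> {a..m} \<Longrightarrow> (f has_real_derivative f' x) (at x within {a..m})"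
    and g: "\<And>x. x \<in> {m..b} \<Longrightarrow> (g has_real_derivative g' x) (at x within {m..b})"
    and m: "a \<le> m" "m \<le> b" "f m = g m" "f' m = g' m" and x: "x \<in> {a..b}"
  shows "((\<lambda>x. if x \<in> {a..m} then f x else g x) has_real_derivative
      (if x \<in> {a..m} then f' x else g' x)) (at x within {a..b})"
proof -
  have S: "{a..m} \<union> closure {a..m} \<inter> closure {m..b} = {a..m}"
    "{m..b} \<union> closure {a..m} \<inter> closure {m..b} = {m..b}" using m by auto
  show ?thesis
    unfolding has_real_derivative_iff_has_vector_derivative
  proof (rule has_vector_derivative_If_within_closures[where T = "{m..b}"], goal_cases)
    case 3
    then show ?case using f[of x] unfolding S has_real_derivative_iff_has_vector_derivative by auto
  next
    case 4
    then show ?case using g[of x] unfolding S has_real_derivative_iff_has_vector_derivative by auto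
  qed (use x m in auto)
qed

lemma reflect_has_derivative:
  fixes f :: "real \<Rightarrow> real"
  assumes "\<And>x. x \<in> {0..1/2} \<Longrightarrow> (f has_real_derivative f' x) (at x within {0..1/2})"
    and x: "x \<in> {1/2..1}"
  shows "((\<lambda>x. f (1 - x)) has_real_derivative - f' (1 - x)) (at x within {1/2..1})"
proof -
  have "(\<lambda>x. 1 - x) ` {1/2..1} \<subseteq> {0..1/2::real}" by auto
  then have "(f has_real_derivative f' (1 - x)) (at (1 - x) within (\<lambda>x. 1 - x) ` {1/2..1})"
    using x by (intro has_field_derivative_subset[OF assms(1)]) auto
  moreover have "((\<lambda>x. 1 - x) has_real_derivative - 1) (at x within {1/2..1})"
    by (auto intro!: derivative_eq_intros)
  ultimately show ?thesis
    using DERIV_image_chain by (fastforce simp: comp_def)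
qed

text \<open>Differentiation under the integral sign over a fixed interval. It gives a derivative
  that is continuous up to \<open>s = 0\<close>, which dividing the integral over
  \<open>{0..s}\<close> by \<open>s\<close> would not show directly.\<close>

lemma mean_C1:
  fixes \<psi> :: "real \<Rightarrow> real"
  assumes \<psi>: "\<And>s. s \<in> {0..b} \<Longrightarrow> (\<psi> has_real_derivative \<psi>' s) (at s within {0..b})"
    and c: "continuous_on {0..b} \<psi>'"
  obtains A' where "continuous_on {0..b} A'"
    "\<And>s. s \<in> {0..b} \<Longrightarrow>
      ((\<lambda>s. integral {0..1} (\<lambda>\<tau>. \<psi> (s * \<tau>))) has_real_derivative A' s) (at s within {0..b})"
proof (rule that[of "\<lambda>s. integral {0..1} (\<lambda>\<tau>. \<psi>' (s * \<tau>) * \<tau>)"])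
  have cc: "continuous_on ({0..b} \<times> cbox 0 1) (\<lambda>(s, \<tau>). \<psi>' (s * \<tau>) * \<tau>)"
    unfolding case_prod_beta
    by (intro continuous_intros continuous_on_compose2[OF c])
       (auto intro: mult_mem_interval simp del: atLeastAtMost_iff)
  from integral_continuous_on_param[OF this]
  show "continuous_on {0..b} (\<lambda>s. integral {0..1} (\<lambda>\<tau>. \<psi>' (s * \<tau>) * \<tau>))" by simp
  have c\<psi>: "continuous_on {0..b} \<psi>" by (rule DERIV_continuous_on[OF \<psi>])
  fix s :: real assume s: "s \<in> {0..b}"
  have "((\<lambda>s. integral (cbox 0 1) (\<lambda>\<tau>. \<psi> (s * \<tau>))) has_real_derivative
      integral (cbox 0 1) (\<lambda>\<tau>. \<psi>' (s * \<tau>) * \<tau>)) (at s within {0..b})"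
  proof (rule leibniz_rule_field_derivative[OF _ _ cc s])
    fix x t :: real assume x: "x \<in> {0..b}" and t: "t \<in> cbox 0 1"
    have "(\<lambda>x. x * t) ` {0..b} \<subseteq> {0..b}" using t mult_mem_interval by auto
    then have "(\<psi> has_real_derivative \<psi>' (x * t)) (at (x * t) within (\<lambda>x. x * t) ` {0..b})"
      using mult_mem_interval[OF x] t by (intro has_field_derivative_subset[OF \<psi>]) auto
    moreover have "((\<lambda>x. x * t) has_real_derivative t) (at x within {0..b})"
      by (auto intro!: derivative_eq_intros)
    ultimately show "((\<lambda>x. \<psi> (x * t)) has_real_derivative \<psi>' (x * t) * t) (at x within {0..b})"
      using DERIV_image_chain by (fastforce simp: comp_def)
  next
    fix x :: real assume x: "x \<in> {0..b}"
    show "(\<lambda>\<tau>. \<psi> (x * \<tau>)) integrable_on cbox 0 1"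
      using x by (intro integrable_continuous continuous_on_compose2[OF c\<psi>] continuous_intros)
        (auto intro: mult_mem_interval simp del: atLeastAtMost_iff)
  qed simp
  then show "((\<lambda>s. integral {0..1} (\<lambda>\<tau>. \<psi> (s * \<tau>))) has_real_derivative
      integral {0..1} (\<lambda>\<tau>. \<psi>' (s * \<tau>) * \<tau>)) (at s within {0..b})" by simp
qed

text \<open>Even reflection of the half profile at \<open>s = 1/2\<close>. The first derivative is
  reflected oddly and matches because it vanishes there; the second is reflected evenly. The angle
  continues as \<open>2 * real j * pi - \<phi> (1 - s)\<close>, matching because
  \<open>\<phi> (1/2) = real j * pi\<close>.\<close>

lemma profile_exists:
  fixes n j :: nat
  assumes \<mu>: "\<mu> > 2 * real n * (2 * real n + 1)" and j: "1 \<le> j" "j \<le> n"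
  obtains V V1 V2 \<Phi> r :: "real \<Rightarrow> real" where
    "\<And>s. s \<in> {0..1} \<Longrightarrow> (V has_real_derivative V1 s) (at s within {0..1})"
    "\<And>s. s \<in> {0..1} \<Longrightarrow> (V1 has_real_derivative V2 s) (at s within {0..1})"
    "continuous_on {0..1} V2"
    "\<And>s. s \<in> {0..1} \<Longrightarrow> s * (1 - s) * V2 s + (1 - 2 * s) * V1 s = \<mu> / 4 * (V s - V s ^ 5)"
    "\<And>s. s \<in> {0..1} \<Longrightarrow> V s > 0" "V 0 < 1" "\<And>s. s \<in> {0..1} \<Longrightarrow> V (1 - s) = V s"
    "continuous_on {0..1} \<Phi>" "strict_mono_on {0..1} \<Phi>" "\<Phi> 0 = 0" "\<Phi> 1 = 2 * real j * pi"
    "\<And>s. s \<in> {0<..<1} \<Longrightarrow> r s > 0" "\<And>s. s \<in> {0<..<1} \<Longrightarrow> V1 s = r s * sin (\<Phi> s)"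
proof -
  obtain W a \<phi> q :: "real \<Rightarrow> real" where W0: "W 0 < 1" and Wpos: "\<And>s. s \<in> {0..1/2} \<Longrightarrow> W s > 0"
    and ca: "continuous_on {0..1/2} a"
    and a: "\<And>s. s \<in> {0..1/2} \<Longrightarrow> a s = integral {0..1} (\<lambda>\<tau>. \<mu> / 4 * (W (s * \<tau>) - W (s * \<tau>) ^ 5))"
    and dW: "\<And>s. s \<in> {0..1/2} \<Longrightarrow> (W has_real_derivative a s / (1 - s)) (at s within {0..1/2})"
    and c\<phi>: "continuous_on {0..1/2} \<phi>" and mono: "strict_mono_on {0..1/2} \<phi>"
    and \<phi>0: "\<phi> 0 = 0" and \<phi>1: "\<phi> (1/2) = real j * pi"
    and q: "\<And>s. s \<in> {0..1/2} \<Longrightarrow> q s > 0" and sin: "\<And>s. s \<in> {0..1/2} \<Longrightarrow> s * a s = q s * sin (\<phi> s)"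
    by (rule half_profile_exists[OF \<mu> j], rule that)
  define g where "g s = \<mu> / 4 * (W s - W s ^ 5)" for s
  define g' where "g' s = \<mu> / 4 * (a s / (1 - s) - 5 * W s ^ 4 * (a s / (1 - s)))" for s
  have cW: "continuous_on {0..1/2} W" by (rule DERIV_continuous_on[OF dW])
  have dg: "(g has_real_derivative g' s) (at s within {0..1/2})" if "s \<in> {0..1/2}" for s
    unfolding g_def g'_def
    using DERIV_cmult[OF DERIV_diff[OF dW[OF that] DERIV_power[OF dW[OF that], of 5]], of "\<mu> / 4"]
    by (simp add: mult_ac)
  have cg': "continuous_on {0..1/2} g'"
    unfolding g'_def by (intro continuous_intros ca cW) auto
  obtain a' where ca': "continuous_on {0..1/2} a'"
    and da': "\<And>s. s \<in> {0..1/2} \<Longrightarrow>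
      ((\<lambda>s. integral {0..1} (\<lambda>\<tau>. g (s * \<tau>))) has_real_derivative a' s) (at s within {0..1/2})"
    by (rule mean_C1[OF dg cg'], assumption, rule that)
  have da: "(a has_real_derivative a' s) (at s within {0..1/2})" if s: "s \<in> {0..1/2}" for s
    by (rule has_field_derivative_transform_within[OF da'[OF s] zero_less_one s])
       (simp only: a g_def)
  \<comment> \<open>Both sides are the derivative of \<open>s * a s\<close>: one by the product
    rule, the other from the averaging formula.\<close>
  have a_eq: "a s + s * a' s = g s" if s: "s \<in> {0..1/2}" for s
  proof -
    have 1: "((\<lambda>s. s * a s) has_real_derivative a s + s * a' s) (at s within {0..1/2})"
      by (auto intro!: derivative_eq_intros da[OF s])
    have "((\<lambda>s. s * integral {0..1} (\<lambda>\<tau>. g (s * \<tau>))) has_real_derivative g s) (at s within {0..1/2})"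
      by (rule mean_has_derivative[OF DERIV_continuous_on[OF dg] s])
    then have 2: "((\<lambda>s. s * a s) has_real_derivative g s) (at s within {0..1/2})"
      by (rule has_field_derivative_transform_within[OF _ zero_less_one s]) (simp only: a g_def)
    show ?thesis
      by (rule vector_derivative_unique_within_closed_interval[of 0 "1/2" s "\<lambda>s. s * a s"])
         (use s 1 2 in \<open>auto simp: has_real_derivative_iff_has_vector_derivative\<close>)
  qed
  define w1 w2 where "w1 s = a s / (1 - s)" and "w2 s = (a' s * (1 - s) + a s) / (1 - s)\<^sup>2" for s
  have dW1: "(W has_real_derivative w1 s) (at s within {0..1/2})" if "s \<in> {0..1/2}" for s
    using dW[OF that] by (simp add: w1_def)
  have dw1: "(w1 has_real_derivative w2 s) (at s within {0..1/2})" if "s \<in> {0..1/2}" for s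
    unfolding w1_def[abs_def] w2_def using that
    by (auto intro!: derivative_eq_intros da simp: power2_eq_square)
  have cw2: "continuous_on {0..1/2} w2"
    unfolding w2_def by (intro continuous_intros ca ca') auto
  have ode: "s * (1 - s) * w2 s + (1 - 2 * s) * w1 s = g s" if s: "s \<in> {0..1/2}" for s
  proof -
    have x: "a s = w1 s * (1 - s)" using s by (auto simp: w1_def)
    then have w2: "w2 s * (1 - s) = a' s + w1 s"
      using s by (simp add: w2_def power2_eq_square flip: distrib_right)
    have "s * (1 - s) * w2 s + (1 - 2 * s) * w1 s = s * (w2 s * (1 - s)) + (1 - 2 * s) * w1 s"
      by simp
    also have "\<dots> = w1 s * (1 - s) + s * a' s"
      unfolding w2 by (simp add: algebra_simps)
    also have "\<dots> = g s" using a_eq[OF s] by (simp only: x)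
    finally show ?thesis .
  qed
  \<comment> \<open>The condition at the reflection point, from
    \<open>sin (real j * pi) = 0\<close>.\<close>
  have w1_half: "w1 (1/2) = 0"
    using sin[of "1/2"] by (simp add: \<phi>1 w1_def)
  define V where "V s = (if s \<in> {0..1/2} then W s else W (1 - s))" for s
  define V1 where "V1 s = (if s \<in> {0..1/2} then w1 s else - w1 (1 - s))" for s
  define V2 where "V2 s = (if s \<in> {0..1/2} then w2 s else w2 (1 - s))" for s
  define \<Phi> where "\<Phi> s = (if s \<in> {0..1/2} then \<phi> s else 2 * real j * pi - \<phi> (1 - s))" for s
  \<comment> \<open>Both halves of \<open>V1\<close> arise from
    \<open>s * a s = q s * sin (\<phi> s)\<close> by dividing by \<open>s * (1 - s)\<close>. This
    weight is positive only in the open interval, which is why the sign formula is stated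
    there.\<close>
  define r where "r s = (if s \<in> {0..1/2} then q s / (s * (1 - s)) else q (1 - s) / (s * (1 - s)))" for s
  show thesis
  proof (rule that[of V V1 V2 \<Phi> r])
    show "(V has_real_derivative V1 s) (at s within {0..1})" if s: "s \<in> {0..1}" for s
      unfolding V_def[abs_def] V1_def
      by (rule has_real_derivative_glue[OF dW1 reflect_has_derivative[OF dW1]])
         (use s in \<open>auto simp: w1_half\<close>)
    show "(V1 has_real_derivative V2 s) (at s within {0..1})" if s: "s \<in> {0..1}" for s
    proof -
      have "((\<lambda>x. - w1 (1 - x)) has_real_derivative w2 (1 - x)) (at x within {1/2..1})"
        if "x \<in> {1/2..1}" for x
        using DERIV_minus[OF reflect_has_derivative[OF dw1 that]] by simp
      from has_real_derivative_glue[OF dw1 this] show ?thesis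
        unfolding V1_def[abs_def] V2_def using s by (simp add: w1_half)
    qed
    have glue: "continuous_on {0..1} (\<lambda>s. if s \<in> {0..1/2} then f s else h s)"
      if "continuous_on {0..1/2} f" "continuous_on {1/2..1} h" "f (1/2) = h (1/2)" for f h :: "real \<Rightarrow> real"
    proof -
      have "continuous_on ({0..1/2} \<union> {1/2..1}) (\<lambda>s. if s \<in> {0..1/2} then f s else h s)"
      proof (rule continuous_on_cases[OF closed_atLeastAtMost closed_atLeastAtMost that(1,2)], intro allI impI)
        fix x :: real
        assume "x \<in> {0..1/2} \<and> x \<notin> {0..1/2} \<or> x \<in> {1/2..1} \<and> x \<in> {0..1/2}"
        then have "x = 1/2" by auto
        then show "f x = h x" using that(3) by (simp only:)
      qed
      moreover have "{0..1/2} \<union> {1/2..1} = {0..1::real}" by auto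
      ultimately show ?thesis by simp
    qed
    show "continuous_on {0..1} V2"
      unfolding V2_def[abs_def]
      by (intro glue cw2 continuous_on_compose2[OF cw2] continuous_intros) auto
    show "continuous_on {0..1} \<Phi>"
      unfolding \<Phi>_def[abs_def]
      by (intro glue c\<phi> continuous_on_compose2[OF c\<phi>] continuous_intros) (auto simp: \<phi>1)
    show "s * (1 - s) * V2 s + (1 - 2 * s) * V1 s = \<mu> / 4 * (V s - V s ^ 5)" if "s \<in> {0..1}" for s
      using ode[of s] ode[of "1 - s"] that
      by (auto simp: V_def V1_def V2_def g_def algebra_simps)
    show "V s > 0" if "s \<in> {0..1}" for s
      using that Wpos[of s] Wpos[of "1 - s"] by (auto simp: V_def)
    show "V 0 < 1" using W0 by (simp add: V_def)
    show "V (1 - s) = V s" if "s \<in> {0..1}" for s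
    proof (cases "s = 1/2")
      case False
      then show ?thesis using that by (auto simp: V_def)
    next
      case True
      then have "1 - s = s" by simp
      then show ?thesis by (simp only:)
    qed
    have le: "\<phi> s \<le> real j * pi" if "s \<in> {0..1/2}" for s
      using strict_mono_on_leD[OF mono that, of "1/2"] that \<phi>1 by auto
    have less: "\<phi> s < real j * pi" if "s \<in> {0..<1/2}" for s
      using strict_mono_onD[OF mono, of s "1/2"] that \<phi>1 by auto
    show "strict_mono_on {0..1} \<Phi>"
    proof (rule strict_mono_onI)
      fix s t :: real assume st: "s \<in> {0..1}" "t \<in> {0..1}" "s < t"
      consider "t \<le> 1/2" | "s \<le> 1/2" "t > 1/2" | "s > 1/2" by linarith
      then show "\<Phi> s < \<Phi> t"
      proof cases
        case 1
        then show ?thesis using st strict_mono_onD[OF mono, of s t] by (auto simp: \<Phi>_def)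
      next
        case 2
        then show ?thesis using st le[of s] less[of "1 - t"] by (auto simp: \<Phi>_def)
      next
        case 3
        then show ?thesis using st strict_mono_onD[OF mono, of "1 - t" "1 - s"] by (auto simp: \<Phi>_def)
      qed
    qed
    show "r s > 0" if "s \<in> {0<..<1}" for s
      using that q[of s] q[of "1 - s"] by (auto simp: r_def)
    show "V1 s = r s * sin (\<Phi> s)" if s: "s \<in> {0<..<1}" for s
    proof (cases "s \<le> 1/2")
      case True
      then show ?thesis using s sin[of s] by (auto simp: V1_def r_def \<Phi>_def w1_def field_simps)
    next
      case False
      have "sin (2 * real j * pi - \<phi> (1 - s)) = - sin (\<phi> (1 - s))"
        using sin_2npi[of j] cos_2npi[of j] by (simp add: sin_diff mult_ac)
      moreover have "a (1 - s) = q (1 - s) * sin (\<phi> (1 - s)) / (1 - s)"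
        using False s sin[of "1 - s"] by (simp add: eq_divide_eq mult.commute)
      ultimately show ?thesis using False s
        by (simp add: V1_def r_def \<Phi>_def w1_def mult.commute)
    qed
  qed (use \<phi>0 in \<open>auto simp: \<Phi>_def\<close>)
qed

section \<open>Counting local maxima\<close>

lemma sin_int_pi_shift:
  "sin (of_int m * pi + x) = (if even m then sin x else - sin x)" for x :: real
proof -
  have "cos (of_int m * pi) = (if even m then 1 else - 1 :: real)"
    using cos_npi_int[of m] by (simp add: mult.commute)
  moreover have "sin (of_int m * pi) = (0 :: real)"
    by (auto simp: sin_zero_iff_int2)
  ultimately show ?thesis by (simp add: sin_add)
qed

text \<open>Critical points are the points where \<Phi> is a multiple of \<open>pi\<close>. Since
  \<Phi> increases strictly, the derivative changes from plus to minus at odd multiples and from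
  minus to plus at even ones. Exactly \<open>j\<close> odd multiples lie between 0 and
  \<open>2 * real j * pi\<close>, each attained once.\<close>

lemma card_local_maxima:
  fixes f \<Phi> r :: "real \<Rightarrow> real"
  assumes c: "continuous_on {a..b} \<Phi>" and mono: "strict_mono_on {a..b} \<Phi>"
    and ab: "a < b" "\<Phi> a = 0" "\<Phi> b = 2 * real j * pi"
    and d: "\<And>x. x \<in> {a<..<b} \<Longrightarrow> DERIV f x :> r x * sin (\<Phi> x)"
    and r: "\<And>x. x \<in> {a<..<b} \<Longrightarrow> r x > 0"
  shows "finite {x \<in> {a<..<b}. local_max_at f x}" "card {x \<in> {a<..<b}. local_max_at f x} = j"
proof -
  \<comment> \<open>Within distance \<open>pi\<close> of a zero of the sine there is no further
    zero, so the sign of the derivative is constant on each side of a critical point.\<close>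
  have near: "\<exists>\<delta>>0. \<forall>t. \<bar>t - x\<bar> < \<delta> \<longrightarrow> t \<in> {a<..<b} \<and> \<bar>\<Phi> t - \<Phi> x\<bar> < pi" if x: "x \<in> {a<..<b}" for x
  proof -
    have "isCont \<Phi> x"
      using continuous_on_interior[OF c] x by simp
    then have "(\<Phi> \<longlongrightarrow> \<Phi> x) (nhds x)"
      by (simp add: isCont_def tendsto_at_iff_tendsto_nhds)
    then have "\<forall>\<^sub>F t in nhds x. dist (\<Phi> t) (\<Phi> x) < pi"
      using pi_gt_zero by (rule tendstoD)
    moreover have "\<forall>\<^sub>F t in nhds x. t \<in> {a<..<b}"
      using x by (intro eventually_nhds_in_open) auto
    ultimately have "\<forall>\<^sub>F t in nhds x. t \<in> {a<..<b} \<and> \<bar>\<Phi> t - \<Phi> x\<bar> < pi"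
      by eventually_elim (auto simp: dist_real_def)
    then show ?thesis by (auto simp: eventually_nhds_metric dist_real_def)
  qed
  have cf: "continuous_on {a<..<b} f"
    using DERIV_isCont[OF d] by (intro continuous_at_imp_continuous_on) auto
  have incr: "f s < f t" if "s < t" "{s..t} \<subseteq> {a<..<b}" "\<And>u. s < u \<Longrightarrow> u < t \<Longrightarrow> sin (\<Phi> u) > 0" for s t
  proof (rule DERIV_pos_imp_increasing_open[OF \<open>s < t\<close>])
    show "\<exists>y. DERIV f u :> y \<and> y > 0" if u: "s < u" "u < t" for u
    proof -
      have "u \<in> {a<..<b}" using u \<open>{s..t} \<subseteq> _\<close> by (auto dest!: subsetD[where c = u])
      then show ?thesis using d[of u] r[of u] \<open>\<And>u. s < u \<Longrightarrow> u < t \<Longrightarrow> sin (\<Phi> u) > 0\<close>[OF u] by (auto intro!: exI)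
    qed
    show "continuous_on {s..t} f"
      using \<open>{s..t} \<subseteq> _\<close> by (rule continuous_on_subset[OF cf])
  qed
  have decr: "f s > f t" if "s < t" "{s..t} \<subseteq> {a<..<b}" "\<And>u. s < u \<Longrightarrow> u < t \<Longrightarrow> sin (\<Phi> u) < 0" for s t
  proof (rule DERIV_neg_imp_decreasing_open[OF \<open>s < t\<close>])
    show "\<exists>y. DERIV f u :> y \<and> y < 0" if u: "s < u" "u < t" for u
    proof -
      have "u \<in> {a<..<b}" using u \<open>{s..t} \<subseteq> _\<close> by (auto dest!: subsetD[where c = u])
      then show ?thesis using d[of u] r[of u] \<open>\<And>u. s < u \<Longrightarrow> u < t \<Longrightarrow> sin (\<Phi> u) < 0\<close>[OF u]
        by (auto intro!: exI simp: mult_less_0_iff)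
    qed
    show "continuous_on {s..t} f"
      using \<open>{s..t} \<subseteq> _\<close> by (rule continuous_on_subset[OF cf])
  qed
  have range: "0 < \<Phi> x" "\<Phi> x < 2 * real j * pi" if "x \<in> {a<..<b}" for x
    using strict_mono_onD[OF mono, of a x] strict_mono_onD[OF mono, of x b] that ab by auto
  have iff: "local_max_at f x \<longleftrightarrow> (\<exists>i<j. \<Phi> x = (2 * real i + 1) * pi)" if x: "x \<in> {a<..<b}" for x
  proof
    assume lm: "local_max_at f x"
    obtain \<delta> where \<delta>: "\<delta> > 0" "\<And>t. \<bar>t - x\<bar> < \<delta> \<Longrightarrow> t \<in> {a<..<b} \<and> \<bar>\<Phi> t - \<Phi> x\<bar> < pi"
      using near[OF x] by auto
    obtain \<epsilon> where \<epsilon>: "\<epsilon> > 0" "\<And>t. t \<noteq> x \<Longrightarrow> \<bar>t - x\<bar> < \<epsilon> \<Longrightarrow> f t \<le> f x"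
      using lm by (auto simp: local_max_at_def eventually_at dist_real_def)
    have "\<forall>t. \<bar>x - t\<bar> < \<epsilon> \<longrightarrow> f t \<le> f x"
      using \<epsilon>(2) by (metis abs_minus_commute order_refl)
    then have "r x * sin (\<Phi> x) = 0"
      by (rule DERIV_local_max[OF d[OF x] \<epsilon>(1)])
    then obtain m :: int where m: "\<Phi> x = of_int m * pi"
      using r[OF x] by (auto simp: sin_zero_iff_int2)
    have "odd m"
    proof
      assume "even m"
      \<comment> \<open>A point to the right of \<open>x\<close> within both radii: \<open>f\<close>
        increases strictly up to it at an even multiple, contradicting even a weak maximum.\<close>
      define t where "t = x + min \<delta> \<epsilon> / 2"
      have t: "x < t" "\<bar>t - x\<bar> < \<delta>" "\<bar>t - x\<bar> < \<epsilon>" using \<delta>(1) \<epsilon>(1) by (auto simp: t_def)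
      have "f x < f t"
      proof (rule incr[OF t(1)])
        show "{x..t} \<subseteq> {a<..<b}"
        proof
          fix u assume "u \<in> {x..t}"
          then have "\<bar>u - x\<bar> < \<delta>" using t by auto
          then show "u \<in> {a<..<b}" using \<delta>(2) by blast
        qed
        fix u assume u: "x < u" "u < t"
        then have "u \<in> {a<..<b}" "\<bar>\<Phi> u - \<Phi> x\<bar> < pi" using \<delta>(2)[of u] t by auto
        moreover from this have "\<Phi> x < \<Phi> u" using strict_mono_onD[OF mono, of x u] u x by auto
        ultimately have "sin (\<Phi> u - \<Phi> x) > 0" by (intro sin_gt_zero) auto
        then show "sin (\<Phi> u) > 0"
          using sin_int_pi_shift[of m "\<Phi> u - \<Phi> x"] \<open>even m\<close> m by simp
      qed
      then show False using \<epsilon>(2)[of t] t by auto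
    qed
    moreover have "0 < m" "m < 2 * int j"
      using range[OF x] unfolding m by (auto simp: zero_less_mult_iff)
    ultimately have "m = 2 * int (nat (m div 2)) + 1 \<and> nat (m div 2) < j"
      by (auto elim!: oddE)
    then obtain i where "m = 2 * int i + 1" "i < j"
      by blast
    then show "\<exists>i<j. \<Phi> x = (2 * real i + 1) * pi" using m by auto
  next
    assume "\<exists>i<j. \<Phi> x = (2 * real i + 1) * pi"
    then obtain i where i: "\<Phi> x = of_int (2 * int i + 1) * pi" by auto
    obtain \<delta> where \<delta>: "\<delta> > 0" "\<And>t. \<bar>t - x\<bar> < \<delta> \<Longrightarrow> t \<in> {a<..<b} \<and> \<bar>\<Phi> t - \<Phi> x\<bar> < pi"
      using near[OF x] by auto
    have s: "sin (\<Phi> u) = - sin (\<Phi> u - \<Phi> x)" for u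
      using sin_int_pi_shift[of "2 * int i + 1" "\<Phi> u - \<Phi> x"] unfolding i[symmetric] by simp
    have "f t \<le> f x" if t: "\<bar>t - x\<bar> < \<delta>" for t
    proof (cases t x rule: linorder_cases)
      case less
      have "f t < f x"
      proof (rule incr[OF less])
        show "{t..x} \<subseteq> {a<..<b}"
        proof
          fix u assume "u \<in> {t..x}"
          then have "\<bar>u - x\<bar> < \<delta>" using t by auto
          then show "u \<in> {a<..<b}" using \<delta>(2) by blast
        qed
        fix u assume u: "t < u" "u < x"
        then have "u \<in> {a<..<b}" "\<bar>\<Phi> u - \<Phi> x\<bar> < pi" using \<delta>(2)[of u] t by auto
        moreover from this have "\<Phi> u < \<Phi> x" using strict_mono_onD[OF mono, of u x] u x by auto
        ultimately have "sin (\<Phi> x - \<Phi> u) > 0" by (intro sin_gt_zero) auto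
        then show "sin (\<Phi> u) > 0" unfolding s[of u] by (metis minus_diff_eq sin_minus)
      qed
      then show ?thesis by simp
    next
      case greater
      have "f x > f t"
      proof (rule decr[OF greater])
        show "{x..t} \<subseteq> {a<..<b}"
        proof
          fix u assume "u \<in> {x..t}"
          then have "\<bar>u - x\<bar> < \<delta>" using t by auto
          then show "u \<in> {a<..<b}" using \<delta>(2) by blast
        qed
        fix u assume u: "x < u" "u < t"
        then have "u \<in> {a<..<b}" "\<bar>\<Phi> u - \<Phi> x\<bar> < pi" using \<delta>(2)[of u] t by auto
        moreover from this have "\<Phi> x < \<Phi> u" using strict_mono_onD[OF mono, of x u] u x by auto
        ultimately have "sin (\<Phi> u - \<Phi> x) > 0" by (intro sin_gt_zero) auto
        then show "sin (\<Phi> u) < 0" unfolding s[of u] by simp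
      qed
      then show ?thesis by simp
    qed simp
    then show "local_max_at f x"
      using \<delta>(1) by (auto simp: local_max_at_def eventually_at dist_real_def)
  qed
  have "\<exists>x\<in>{a<..<b}. \<Phi> x = (2 * real i + 1) * pi" if i: "i < j" for i
  proof -
    have "(2 * real i + 1) * pi < 2 * real j * pi" using i by (intro mult_strict_right_mono) auto
    then have "\<exists>x\<ge>a. x \<le> b \<and> \<Phi> x = (2 * real i + 1) * pi"
      using ab by (intro IVT' c) auto
    then obtain x where x: "a \<le> x" "x \<le> b" "\<Phi> x = (2 * real i + 1) * pi" by blast
    have "(2 * real i + 1) * pi > 0" by (intro mult_pos_pos) auto
    then have "x \<noteq> a" "x \<noteq> b" using x ab \<open>_ < 2 * real j * pi\<close> by auto
    then show ?thesis using x by auto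
  qed
  then obtain y where y: "\<And>i. i < j \<Longrightarrow> y i \<in> {a<..<b} \<and> \<Phi> (y i) = (2 * real i + 1) * pi"
    by metis
  have inj: "inj_on y {..<j}"
  proof (rule inj_onI)
    fix i l assume "i \<in> {..<j}" "l \<in> {..<j}" "y i = y l"
    then have "(2 * real i + 1) * pi = (2 * real l + 1) * pi" using y by (metis lessThan_iff)
    then show "i = l" by simp
  qed
  have "{x \<in> {a<..<b}. local_max_at f x} = y ` {..<j}"
  proof (intro equalityI subsetI)
    fix x assume "x \<in> {x \<in> {a<..<b}. local_max_at f x}"
    then have x: "x \<in> {a<..<b}" and "local_max_at f x" by auto
    then obtain i where i: "i < j" "\<Phi> x = (2 * real i + 1) * pi" using iff by blast
    then have "x = y i"
      using y[of i] x strict_mono_on_imp_inj_on[OF mono] by (auto simp: inj_on_def)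
    then show "x \<in> y ` {..<j}" using i by auto
  next
    fix x assume "x \<in> y ` {..<j}"
    then obtain i where i: "i < j" "x = y i" by auto
    then show "x \<in> {x \<in> {a<..<b}. local_max_at f x}" using y[of i] iff[of x] by auto
  qed
  then show "finite {x \<in> {a<..<b}. local_max_at f x}" "card {x \<in> {a<..<b}. local_max_at f x} = j"
    using inj by (auto simp: card_image)
qed

section \<open>The Laplacian of rotational functions\<close>

lemma vector_4:
  "(vector [x, y, z, w] :: 'a::zero^4) $ 1 = x"
  "(vector [x, y, z, w] :: 'a::zero^4) $ 2 = y"
  "(vector [x, y, z, w] :: 'a::zero^4) $ 3 = z"
  "(vector [x, y, z, w] :: 'a::zero^4) $ 4 = w"
  unfolding vector_def by simp_all

lemma sum_sq_34_mem:
  fixes p :: "real^4"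
  assumes "p \<in> S3"
  shows "(p $ 3)\<^sup>2 + (p $ 4)\<^sup>2 \<in> {0..1}"
proof -
  have "p \<bullet> p = 1" using assms by (simp add: dot_square_norm)
  then have "(p $ 1)\<^sup>2 + (p $ 2)\<^sup>2 + (p $ 3)\<^sup>2 + (p $ 4)\<^sup>2 = 1"
    by (simp add: inner_vec_def sum_4 power2_eq_square)
  then show ?thesis
    using zero_le_power2[of "p $ 1"] zero_le_power2[of "p $ 2"]
    unfolding atLeastAtMost_iff by (intro conjI) (simp, linarith)
qed

context
  fixes V V1 V2 :: "real \<Rightarrow> real"
  assumes dV: "\<And>s. s \<in> {0..1} \<Longrightarrow> (V has_real_derivative V1 s) (at s within {0..1})"
    and dV1: "\<And>s. s \<in> {0..1} \<Longrightarrow> (V1 has_real_derivative V2 s) (at s within {0..1})"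
    and cV2: "continuous_on {0..1} V2"
begin

text \<open>The orthogonal projection onto the plane of the last two coordinates;
  \<open>2 *\<^sub>R J p\<close> is the Euclidean gradient of \<open>q\<close>.\<close>

private definition J :: "real^4 \<Rightarrow> real^4" where "J p = vector [0, 0, p $ 3, p $ 4]"

private definition q :: "real^4 \<Rightarrow> real" where "q p = (p $ 3)\<^sup>2 + (p $ 4)\<^sup>2"

text \<open>The Euclidean gradient \<open>2 * V1 (q p)\<close> times \<open>J p\<close>, made
  tangential by removing its component along \<open>p\<close>; note that
  \<open>J p \<bullet> p = q p\<close>.\<close>

private definition X :: "real^4 \<Rightarrow> real^4" where
  "X p = (2 * V1 (q p)) *\<^sub>R (J p - q p *\<^sub>R p)"

private definition DX :: "real^4 \<Rightarrow> real^4 \<Rightarrow> real^4" where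
  "DX p h = (2 * V1 (q p)) *\<^sub>R (J h - (q p *\<^sub>R h + (2 * (J p \<bullet> h)) *\<^sub>R p))
     + (2 * (V2 (q p) * (2 * (J p \<bullet> h)))) *\<^sub>R (J p - q p *\<^sub>R p)"

private lemma J_nth: "J p $ 1 = 0" "J p $ 2 = 0" "J p $ 3 = p $ 3" "J p $ 4 = p $ 4"
  by (simp_all add: J_def vector_4)

private lemma J_inner: "J p \<bullet> h = p $ 3 * h $ 3 + p $ 4 * h $ 4"
  by (simp add: inner_vec_def sum_4 J_nth)

private lemma J_inner_self: "J p \<bullet> p = q p"
  by (simp add: J_inner q_def power2_eq_square)

private lemma bounded_linear_J: "bounded_linear J"
  unfolding linear_conv_bounded_linear[symmetric]
  by (rule linearI) (simp_all add: vec_eq_iff forall_4 J_nth)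

private lemma q_mem: "p \<in> S3 \<Longrightarrow> q p \<in> {0..1}"
  unfolding q_def by (rule sum_sq_34_mem)

private lemma q_deriv: "(q has_derivative (\<lambda>h. 2 * (J p \<bullet> h))) (at p within T)"
proof -
  have nth: "((\<lambda>p. p $ i) has_derivative (\<lambda>h. h $ i)) (at p within T)" for i
    by (rule bounded_linear_imp_has_derivative[OF bounded_linear_vec_nth])
  show ?thesis
    unfolding q_def[abs_def] J_inner
    by (rule derivative_eq_intros nth refl)+ (auto simp: algebra_simps)
qed

text \<open>The chain rule within sets: \<open>q\<close> maps the sphere into \<open>{0..1}\<close>,
  so one-sided derivatives at 0 and 1 suffice on the two circles where \<open>q\<close> takes these
  values.\<close>

private lemma compose_q_deriv:
  assumes f: "\<And>s. s \<in> {0..1} \<Longrightarrow> (f has_real_derivative f' s) (at s within {0..1})" and p: "p \<in> S3"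
  shows "((\<lambda>p. f (q p)) has_derivative (\<lambda>h. f' (q p) * (2 * (J p \<bullet> h)))) (at p within S3)"
proof (rule has_derivative_in_compose[OF q_deriv])
  have "q ` S3 \<subseteq> {0..1}" using q_mem by blast
  then show "(f has_derivative (*) (f' (q p))) (at (q p) within q ` S3)"
    using f[OF q_mem[OF p]] unfolding has_field_derivative_def by (rule has_derivative_subset[rotated])
qed

private lemma grad_eq:
  assumes p: "p \<in> S3"
  shows "sphere_grad (\<lambda>p. V (q p)) p = X p"
proof (rule sphere_grad_eqI[OF p])
  have pp: "p \<bullet> p = 1" using p by (simp add: dot_square_norm)
  show "X p \<bullet> p = 0"
    by (simp add: X_def inner_diff_left J_inner_self pp)
  show "((\<lambda>p. V (q p)) has_derivative (\<bullet>) (X p)) (at p within S3)"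
    by (rule has_derivative_eq_rhs[OF tangential_derivative[OF p compose_q_deriv[OF dV p]]])
       (auto simp: fun_eq_iff X_def inner_diff_left J_inner_self inner_commute[of p] algebra_simps)
qed

private lemma X_deriv:
  assumes p: "p \<in> S3"
  shows "(X has_derivative DX p) (at p within S3)"
proof -
  have J': "(J has_derivative J) (at p within S3)"
    by (rule bounded_linear_imp_has_derivative[OF bounded_linear_J])
  have "((\<lambda>p. 2 * V1 (q p)) has_derivative (\<lambda>h. 2 * (V2 (q p) * (2 * (J p \<bullet> h))))) (at p within S3)"
    by (intro has_derivative_mult_right compose_q_deriv[OF dV1 p])
  then show ?thesis
    unfolding X_def[abs_def] DX_def
    by (intro has_derivative_scaleR has_derivative_diff J' q_deriv has_derivative_ident)
qed

private lemma grad_deriv: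
  assumes p: "p \<in> S3"
  shows "(sphere_grad (\<lambda>p. V (q p)) has_derivative DX p) (at p within S3)"
  by (rule has_derivative_transform[OF p _ X_deriv[OF p]]) (rule grad_eq)

text \<open>\<open>DX p\<close> need not annihilate \<open>p\<close>; subtracting its value on the
  normal component gives the representative singled out by \<open>sphere_jacobian\<close>.\<close>

private lemma jacobian_eq:
  assumes p: "p \<in> S3"
  shows "sphere_jacobian (sphere_grad (\<lambda>p. V (q p))) p = matrix (\<lambda>h. DX p h - (h \<bullet> p) *\<^sub>R DX p p)"
proof (rule sphere_jacobian_eqI[OF p])
  have pp: "p \<bullet> p = 1" using p by (simp add: dot_square_norm)
  have D: "(sphere_grad (\<lambda>p. V (q p)) has_derivative (\<lambda>h. DX p h - (h \<bullet> p) *\<^sub>R DX p p)) (at p within S3)"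
    by (rule tangential_derivative[OF p grad_deriv[OF p]])
  have M: "matrix (\<lambda>h. DX p h - (h \<bullet> p) *\<^sub>R DX p p) *v h = DX p h - (h \<bullet> p) *\<^sub>R DX p p" for h
    using has_derivative_linear[OF D] by (simp add: matrix_works)
  show "matrix (\<lambda>h. DX p h - (h \<bullet> p) *\<^sub>R DX p p) *v p = 0"
    unfolding M by (simp add: pp)
  show "(sphere_grad (\<lambda>p. V (q p)) has_derivative (*v) (matrix (\<lambda>h. DX p h - (h \<bullet> p) *\<^sub>R DX p p))) (at p within S3)"
    using D by (simp add: M[abs_def])
qed

lemma C2_on_S3_rotational: "C2_on_S3 (\<lambda>p. V ((p $ 3)\<^sup>2 + (p $ 4)\<^sup>2))"
proof -
  have cq: "continuous_on S3 q" by (intro has_derivative_continuous_on[OF q_deriv])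
  have qS: "q ` S3 \<subseteq> {0..1}" using q_mem by blast
  have c1: "continuous_on S3 (\<lambda>p. V1 (q p))"
    by (rule continuous_on_compose2[OF DERIV_continuous_on[OF dV1] cq qS])
  have c2: "continuous_on S3 (\<lambda>p. V2 (q p))"
    by (rule continuous_on_compose2[OF cV2 cq qS])
  have cJ: "continuous_on S3 J"
    by (rule linear_continuous_on[OF bounded_linear_J])
  have cDX: "continuous_on S3 (\<lambda>p. DX p (g p))" if "continuous_on S3 g" for g
    unfolding DX_def
    by (intro continuous_intros c1 c2 cq cJ that continuous_on_compose2[OF linear_continuous_on[OF bounded_linear_J]]) auto
  have "continuous_on S3 (\<lambda>p. matrix (\<lambda>h. DX p h - (h \<bullet> p) *\<^sub>R DX p p))"
    unfolding matrix_def
    by (intro continuous_on_vec_lambda continuous_on_component continuous_intros cDX)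
  then have "continuous_on S3 (sphere_jacobian (sphere_grad (\<lambda>p. V (q p))))"
    by (rule continuous_on_eq) (simp add: jacobian_eq)
  moreover have "(\<lambda>p. V (q p)) differentiable_on S3"
    unfolding differentiable_on_def differentiable_def using compose_q_deriv[OF dV] by blast
  moreover have "sphere_grad (\<lambda>p. V (q p)) differentiable_on S3"
    unfolding differentiable_on_def differentiable_def using grad_deriv by blast
  ultimately show ?thesis by (simp add: C2_on_S3_def q_def)
qed

text \<open>The Laplacian is the full trace of \<open>DX p\<close> minus its entry in the normal
  direction. For \<open>s = (sin \<theta>)\<^sup>2\<close> with 0 < \<theta> < pi/2 the result is
  the operator \<open>u'' + 2 cos (2 \<theta>) / sin (2 \<theta>) u'\<close>, here without a
  singular coefficient.\<close>

lemma laplace_beltrami_rotational: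
  assumes p: "p \<in> S3" and s: "s = (p $ 3)\<^sup>2 + (p $ 4)\<^sup>2"
  shows "laplace_beltrami (\<lambda>p. V ((p $ 3)\<^sup>2 + (p $ 4)\<^sup>2)) p = 4 * (s * (1 - s) * V2 s + (1 - 2 * s) * V1 s)"
proof -
  define a b where "a = V1 s" and "b = V2 s"
  have qp: "q p = s" by (simp add: q_def s)
  have "laplace_beltrami (\<lambda>p. V (q p)) p = trace (matrix (\<lambda>h. DX p h - (h \<bullet> p) *\<^sub>R DX p p))"
    by (simp add: laplace_beltrami_def sphere_div_def jacobian_eq[OF p])
  also have "\<dots> = (\<Sum>i\<in>UNIV. DX p (axis i 1) $ i) - p \<bullet> DX p p"
    by (simp add: trace_def matrix_def sum_subtractf inner_vec_def[of p] inner_axis' )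
  also have "p \<bullet> DX p p = - 4 * s * a"
    using p by (simp add: DX_def inner_add_right inner_diff_right J_inner_self inner_commute[of p "J p"] qp dot_square_norm a_def algebra_simps)
  also have "(\<Sum>i\<in>UNIV. DX p (axis i 1) $ i) = 4 * b * (s - s\<^sup>2) + 2 * a * (2 - 6 * s)"
    by (simp add: sum_4 DX_def J_nth J_inner qp axis_def a_def[symmetric] b_def[symmetric])
       (use s in algebra)
  finally show ?thesis by (simp add: q_def a_def b_def algebra_simps power2_eq_square)
qed

end

section \<open>Solutions\<close>

lemma sin_sq_mem: "(sin x)\<^sup>2 \<in> {0..1}" for x :: real
  by (simp add: abs_square_le_1)

lemma sin_sq_strict_mono:
  fixes x y :: real
  assumes "x \<in> {0..pi/2}" "y \<in> {0..pi/2}" "x < y"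
  shows "(sin x)\<^sup>2 < (sin y)\<^sup>2"
proof -
  have "0 \<le> sin x" using assms by (intro sin_ge_zero) auto
  moreover have "sin x < sin y" using assms by (intro sin_monotone_2pi) auto
  ultimately show ?thesis by (simp add: power_strict_mono)
qed

theorem theorem1p1:
  fixes n :: nat and lam :: real
  assumes "n \<ge> 1"
    and "lam \<in> {- ((2 * real n + 2) * (2 * real n + 3)) ..< - ((2 * real n) * (2 * real n + 1))}"
  shows "\<forall>k\<in>{1..n}. \<exists>(U :: real^4 \<Rightarrow> real) (u :: real \<Rightarrow> real).
      C2_on_S3 U \<and>
      (\<forall>p\<in>S3. laplace_beltrami U p = lam * (U p ^ 5 - U p)) \<and>
      (\<forall>p\<in>S3. U p > 0) \<and>
      (\<forall>\<theta>\<in>{0..pi/2}. \<forall>\<eta>1\<in>{0..2*pi}. \<forall>\<eta>2\<in>{0..2*pi}. U (torus_point \<theta> \<eta>1 \<eta>2) = u \<theta>) \<and>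
      finite {\<theta>\<in>{0<..<pi/2}. local_max_at u \<theta>} \<and>
      card {\<theta>\<in>{0<..<pi/2}. local_max_at u \<theta>} = k \<and>
      (\<forall>\<theta>\<in>{0<..<pi/2}. u (pi/2 - \<theta>) = u \<theta>) \<and>
      u 0 < 1"
proof
  fix k assume k: "k \<in> {1..n}"
  have \<mu>: "- lam > 2 * real n * (2 * real n + 1)" using assms(2) by auto
  have k': "1 \<le> k" "k \<le> n" using k by auto
  obtain V V1 V2 \<Phi> r :: "real \<Rightarrow> real" where
    dV: "\<And>s. s \<in> {0..1} \<Longrightarrow> (V has_real_derivative V1 s) (at s within {0..1})"
    and dV1: "\<And>s. s \<in> {0..1} \<Longrightarrow> (V1 has_real_derivative V2 s) (at s within {0..1})"
    and cV2: "continuous_on {0..1} V2"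
    and ode: "\<And>s. s \<in> {0..1} \<Longrightarrow> s * (1 - s) * V2 s + (1 - 2 * s) * V1 s = - lam / 4 * (V s - V s ^ 5)"
    and Vpos: "\<And>s. s \<in> {0..1} \<Longrightarrow> V s > 0" and V0: "V 0 < 1"
    and sym: "\<And>s. s \<in> {0..1} \<Longrightarrow> V (1 - s) = V s"
    and c\<Phi>: "continuous_on {0..1} \<Phi>" and mono: "strict_mono_on {0..1} \<Phi>"
    and \<Phi>01: "\<Phi> 0 = 0" "\<Phi> 1 = 2 * real k * pi"
    and r: "\<And>s. s \<in> {0<..<1} \<Longrightarrow> r s > 0"
    and V1: "\<And>s. s \<in> {0<..<1} \<Longrightarrow> V1 s = r s * sin (\<Phi> s)"
    by (rule profile_exists[OF \<mu> k'], rule that)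
  define U where "U p = V ((p $ 3)\<^sup>2 + (p $ 4)\<^sup>2)" for p :: "real^4"
  define u where "u \<theta> = V ((sin \<theta>)\<^sup>2)" for \<theta>
  note rot = dV dV1 cV2
  have "C2_on_S3 U"
    unfolding U_def by (rule C2_on_S3_rotational[OF rot])
  moreover have "laplace_beltrami U p = lam * (U p ^ 5 - U p) \<and> U p > 0" if p: "p \<in> S3" for p
  proof -
    define s where "s = (p $ 3)\<^sup>2 + (p $ 4)\<^sup>2"
    have s: "s \<in> {0..1}" unfolding s_def by (rule sum_sq_34_mem[OF p])
    have "laplace_beltrami U p = 4 * (s * (1 - s) * V2 s + (1 - 2 * s) * V1 s)"
      unfolding U_def by (rule laplace_beltrami_rotational[OF rot p s_def])
    then show ?thesis
      using Vpos[OF s] unfolding ode[OF s] by (simp add: U_def s_def algebra_simps)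
  qed
  moreover have "U (torus_point \<theta> \<eta>1 \<eta>2) = u \<theta>" for \<theta> \<eta>1 \<eta>2
  proof -
    have "(sin \<theta> * cos \<eta>2)\<^sup>2 + (sin \<theta> * sin \<eta>2)\<^sup>2 = (sin \<theta>)\<^sup>2"
      using sin_cos_squared_add[of \<eta>2] by algebra
    then show ?thesis by (simp add: U_def u_def torus_point_def vector_4)
  qed
  moreover have "finite {\<theta>\<in>{0<..<pi/2}. local_max_at u \<theta>}" "card {\<theta>\<in>{0<..<pi/2}. local_max_at u \<theta>} = k"
  proof -
    \<comment> \<open>The substitution \<open>s = (sin \<theta>)\<^sup>2\<close> is strictly
      increasing from 0 to 1, so the angle keeps its monotonicity and its end values in the variable
      \<theta>.\<close>
    have c: "continuous_on {0..pi/2} (\<lambda>\<theta>. \<Phi> ((sin \<theta>)\<^sup>2))"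
      using sin_sq_mem by (intro continuous_on_compose2[OF c\<Phi>] continuous_intros) blast
    have m: "strict_mono_on {0..pi/2} (\<lambda>\<theta>. \<Phi> ((sin \<theta>)\<^sup>2))"
      by (intro strict_mono_onI strict_mono_onD[OF mono] sin_sq_mem sin_sq_strict_mono)
    have mem: "(sin \<theta>)\<^sup>2 \<in> {0<..<1}" if "\<theta> \<in> {0<..<pi/2}" for \<theta> :: real
      using sin_sq_strict_mono[of 0 \<theta>] sin_sq_strict_mono[of \<theta> "pi/2"] that by auto
    \<comment> \<open>The chain-rule factor \<open>2 * sin \<theta> * cos \<theta>\<close> is
      positive inside the interval and is absorbed into the weight.\<close>
    have d: "DERIV u \<theta> :> (r ((sin \<theta>)\<^sup>2) * (2 * sin \<theta> * cos \<theta>)) * sin (\<Phi> ((sin \<theta>)\<^sup>2))"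
      if \<theta>: "\<theta> \<in> {0<..<pi/2}" for \<theta>
    proof -
      have "DERIV V ((sin \<theta>)\<^sup>2) :> V1 ((sin \<theta>)\<^sup>2)"
        using mem[OF \<theta>] by (intro DERIV_within_interior[OF dV]) auto
      moreover have "DERIV (\<lambda>\<theta>. (sin \<theta>)\<^sup>2) \<theta> :> 2 * sin \<theta> * cos \<theta>"
        by (auto intro!: derivative_eq_intros)
      ultimately have "DERIV u \<theta> :> V1 ((sin \<theta>)\<^sup>2) * (2 * sin \<theta> * cos \<theta>)"
        unfolding u_def[abs_def] by (rule DERIV_chain2)
      then show ?thesis unfolding V1[OF mem[OF \<theta>]] by (simp add: mult_ac)
    qed
    have pos: "r ((sin \<theta>)\<^sup>2) * (2 * sin \<theta> * cos \<theta>) > 0" if "\<theta> \<in> {0<..<pi/2}" for \<theta>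
      using r[OF mem[OF that]] that by (intro mult_pos_pos sin_gt_zero cos_gt_zero) auto
    show "finite {\<theta>\<in>{0<..<pi/2}. local_max_at u \<theta>}" "card {\<theta>\<in>{0<..<pi/2}. local_max_at u \<theta>} = k"
      using card_local_maxima[OF c m _ _ _ d pos, of k] \<Phi>01 by simp_all
  qed
  moreover have "u (pi/2 - \<theta>) = u \<theta>" for \<theta>
  proof -
    have "(sin (pi/2 - \<theta>))\<^sup>2 = 1 - (sin \<theta>)\<^sup>2"
      by (simp add: sin_diff cos_squared_eq)
    then show ?thesis unfolding u_def using sym[OF sin_sq_mem[of \<theta>]] by (simp only:)
  qed
  moreover have "u 0 < 1" using V0 by (simp add: u_def)
  ultimately show "\<exists>(U :: real^4 \<Rightarrow> real) (u :: real \<Rightarrow> real).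
      C2_on_S3 U \<and>
      (\<forall>p\<in>S3. laplace_beltrami U p = lam * (U p ^ 5 - U p)) \<and>
      (\<forall>p\<in>S3. U p > 0) \<and>
      (\<forall>\<theta>\<in>{0..pi/2}. \<forall>\<eta>1\<in>{0..2*pi}. \<forall>\<eta>2\<in>{0..2*pi}. U (torus_point \<theta> \<eta>1 \<eta>2) = u \<theta>) \<and>
      finite {\<theta>\<in>{0<..<pi/2}. local_max_at u \<theta>} \<and>
      card {\<theta>\<in>{0<..<pi/2}. local_max_at u \<theta>} = k \<and>
      (\<forall>\<theta>\<in>{0<..<pi/2}. u (pi/2 - \<theta>) = u \<theta>) \<and>
      u 0 < 1"
    by blast
qed

end
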